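(* Let $\ell\ge 2$ and let $\mathbf G$ be ${\rm GL}_n$ or ${\rm SL}_n$. For every non-degenerate character $\theta$ of $\mathbf U(\mathfrak o_\ell)$, the representation $\mathrm{Ind}_{\mathbf U(\mathfrak o_\ell)}^{\mathbf G(\mathfrak o_\ell)}(\theta)$ of $\mathbf G(\mathfrak o_\ell)$ is multiplicity free; equivalently, for every irreducible complex representation $\pi$ of $\mathbf G(\mathfrak o_\ell)$, $\dim \mathrm{Hom}_{\mathbf G(\mathfrak o_\ell)}\big(\pi,\mathrm{Ind}_{\mathbf U(\mathfrak o_\ell)}^{\mathbf G(\mathfrak o_\ell)}(\theta)\big)\le 1$.
   Context: Let $\mathbf F$ be a non-archimedean local field with ring of integers $\mathfrak o$, maximal ideal $\mathfrak p=\varpi\mathfrak o$, and finite residue field $\mathbf k=\mathfrak o/\mathfrak p\cong\mathbb F_q$ of characteristic $p$. For $r\ge 1$ put $\mathfrak o_r=\mathfrak o/\mathfrak p^r$. $\mathbf U(\mathfrak o_\ell)$ denotes the group of upper triangular unipotent matrices in $\mathbf G(\mathfrak o_\ell)$. A character $\varphi:(\mathfrak o_\ell,+)\to\mathbb C^\times$ is primitive if its restriction to $\varpi^{\ell-1}\mathfrak o_\ell$ is nontrivial. A non-degenerate character of $\mathbf U(\mathfrak o_\ell)$ is a character of the form $\theta((u_{ij}))=\varphi_1(u_{12})\varphi_2(u_{23})\cdots\varphi_{n-1}(u_{n-1,n})$ where $\varphi_1,\dots,\varphi_{n-1}$ are primitive characters of $\mathfrak o_\ell$. All representations are finite-dimensional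 complex representations. *)

theory Defs
  imports "Jordan_Normal_Form.Determinant"
begin

text \<open>An integral domain o with element w is the ring of integers of a
non-archimedean local field with uniformizer w iff: o is a discrete valuation
ring with uniformizer w (w nonzero non-unit, every nonzero element is a unit
times a power of w), the residue field o/wo is finite, and o is complete
for the w-adic topology.\<close>

definition ring_of_integers_local_field :: "'a::idom \<Rightarrow> bool" where
  "ring_of_integers_local_field w \<longleftrightarrow>
     w \<noteq> 0 \<and> \<not> w dvd 1 \<and>
     (\<forall>x. x \<noteq> 0 \<longrightarrow> (\<exists>u k. u dvd 1 \<and> x = u * w ^ k)) \<and>
     finite ((UNIV :: 'a set) // {(x, y). w dvd (x - y)}) \<and>
     (\<forall>s :: nat \<Rightarrow> 'a. (\<forall>k. w ^ k dvd (s (Suc k) - s k)) \<longrightarrow>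
         (\<exists>x. \<forall>k. w ^ k dvd (x - s k)))"

definition is_quotient_mod_power :: "'a::idom \<Rightarrow> nat \<Rightarrow> ('a \<Rightarrow> 'r::comm_ring_1) \<Rightarrow> bool" where
  "is_quotient_mod_power w l phi \<longleftrightarrow>
     phi 1 = 1 \<and> (\<forall>x y. phi (x + y) = phi x + phi y) \<and>
     (\<forall>x y. phi (x * y) = phi x * phi y) \<and> surj phi \<and>
     (\<forall>x. phi x = 0 \<longleftrightarrow> w ^ l dvd x)"

definition GLn :: "nat \<Rightarrow> 'r::comm_ring_1 mat set" where
  "GLn n = {A \<in> carrier_mat n n. det A dvd 1}"

definition SLn :: "nat \<Rightarrow> 'r::comm_ring_1 mat set" where
  "SLn n = {A \<in> carrier_mat n n. det A = 1}"

definition UTn :: "nat \<Rightarrow> 'r::comm_ring_1 mat set" where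
  "UTn n = {A \<in> carrier_mat n n. \<forall>i<n. \<forall>j<n.
             (j < i \<longrightarrow> A $$ (i, j) = 0) \<and> (i = j \<longrightarrow> A $$ (i, j) = 1)}"

definition additive_character :: "('r::comm_ring_1 \<Rightarrow> complex) \<Rightarrow> bool" where
  "additive_character psi \<longleftrightarrow> (\<forall>x. psi x \<noteq> 0) \<and> (\<forall>x y. psi (x + y) = psi x * psi y)"

text \<open>Primitive: nontrivial on varpi^(l-1) o_l, where varpi = image of w.\<close>
definition primitive_character :: "'r::comm_ring_1 \<Rightarrow> nat \<Rightarrow> ('r \<Rightarrow> complex) \<Rightarrow> bool" where
  "primitive_character varpi l psi \<longleftrightarrow>
     additive_character psi \<and> (\<exists>x. psi (varpi ^ (l - 1) * x) \<noteq> 1)"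

definition nondeg_char :: "nat \<Rightarrow> (nat \<Rightarrow> 'r::comm_ring_1 \<Rightarrow> complex) \<Rightarrow> 'r mat \<Rightarrow> complex" where
  "nondeg_char n psi u = (\<Prod>i<n - 1. psi i (u $$ (i, i + 1)))"

definition is_rep :: "nat \<Rightarrow> 'r::comm_ring_1 mat set \<Rightarrow> nat \<Rightarrow> ('r mat \<Rightarrow> complex mat) \<Rightarrow> bool" where
  "is_rep n G d rho \<longleftrightarrow>
     (\<forall>A\<in>G. rho A \<in> carrier_mat d d) \<and> rho (1\<^sub>m n) = 1\<^sub>m d \<and>
     (\<forall>A\<in>G. \<forall>B\<in>G. rho (A * B) = rho A * rho B)"

definition is_subspace :: "nat \<Rightarrow> complex vec set \<Rightarrow> bool" where
  "is_subspace d W \<longleftrightarrow> W \<subseteq> carrier_vec d \<and> 0\<^sub>v d \<in> W \<and>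
     (\<forall>v\<in>W. \<forall>w\<in>W. v + w \<in> W) \<and> (\<forall>c. \<forall>v\<in>W. c \<cdot>\<^sub>v v \<in> W)"

definition irreducible_rep :: "nat \<Rightarrow> 'r::comm_ring_1 mat set \<Rightarrow> nat \<Rightarrow> ('r mat \<Rightarrow> complex mat) \<Rightarrow> bool" where
  "irreducible_rep n G d rho \<longleftrightarrow> is_rep n G d rho \<and> d > 0 \<and>
     (\<forall>W. is_subspace d W \<and> (\<forall>A\<in>G. \<forall>w\<in>W. rho A *\<^sub>v w \<in> W) \<longrightarrow>
          W = {0\<^sub>v d} \<or> W = carrier_vec d)"

definition ind_space :: "'r::comm_ring_1 mat set \<Rightarrow> 'r mat set \<Rightarrow> ('r mat \<Rightarrow> complex) \<Rightarrow> ('r mat \<Rightarrow> complex) set" where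
  "ind_space G U theta = {f. (\<forall>x. x \<notin> G \<longrightarrow> f x = 0) \<and>
      (\<forall>u\<in>U. \<forall>g\<in>G. f (u * g) = theta u * f g)}"

definition ind_action :: "'r::comm_ring_1 mat set \<Rightarrow> 'r mat \<Rightarrow> ('r mat \<Rightarrow> complex) \<Rightarrow> ('r mat \<Rightarrow> complex)" where
  "ind_action G g f = (\<lambda>x. if x \<in> G then f (x * g) else 0)"

definition intertwiner ::
  "'r::comm_ring_1 mat set \<Rightarrow> 'r mat set \<Rightarrow> ('r mat \<Rightarrow> complex) \<Rightarrow> nat \<Rightarrow> ('r mat \<Rightarrow> complex mat)
     \<Rightarrow> (complex vec \<Rightarrow> ('r mat \<Rightarrow> complex)) \<Rightarrow> bool" where
  "intertwiner G U theta d rho T \<longleftrightarrow>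
     (\<forall>v\<in>carrier_vec d. T v \<in> ind_space G U theta) \<and>
     (\<forall>v\<in>carrier_vec d. \<forall>w\<in>carrier_vec d. T (v + w) = (\<lambda>x. T v x + T w x)) \<and>
     (\<forall>c. \<forall>v\<in>carrier_vec d. T (c \<cdot>\<^sub>v v) = (\<lambda>x. c * T v x)) \<and>
     (\<forall>g\<in>G. \<forall>v\<in>carrier_vec d. T (rho g *\<^sub>v v) = ind_action G g (T v))"

definition hom_dim_le_1 ::
  "'r::comm_ring_1 mat set \<Rightarrow> 'r mat set \<Rightarrow> ('r mat \<Rightarrow> complex) \<Rightarrow> nat \<Rightarrow> ('r mat \<Rightarrow> complex mat) \<Rightarrow> bool" where
  "hom_dim_le_1 G U theta d rho \<longleftrightarrow>
     (\<forall>T1 T2. intertwiner G U theta d rho T1 \<and> intertwiner G U theta d rho T2 \<longrightarrow>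
        (\<exists>c1 c2. (c1 \<noteq> 0 \<or> c2 \<noteq> 0) \<and>
           (\<forall>v\<in>carrier_vec d. \<forall>x. c1 * T1 v x + c2 * T2 v x = 0)))"

end

theory Submission
  imports Defs "Jordan_Normal_Form.Spectral_Radius"
begin

text \<open>
  Gelfand's trick. Write \<open>theta (1 + N) = psi (tr (N J))\<close> with \<open>J\<close> supported on the subdiagonal, with unit
  entries there. A twisted transpose \<open>sigma\<close> along the antidiagonal is an anti-automorphism of \<open>G\<close> that
  preserves \<open>U\<close> and \<open>theta\<close>; it suffices that it fixes every function \<open>f\<close> with
  \<open>f (u g v) = theta u * theta v * f g\<close>.

  There is no usable Bruhat decomposition over a quotient of the ring of integers. Instead, if \<open>f g \<noteq> 0\<close> then
  duality for the trace pairing yields \<open>A g = g B\<close> with \<open>A\<close> and \<open>B\<close> Hessenberg matrices with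
  subdiagonal \<open>J\<close>. The first basis vector is cyclic for such matrices, so they are
  conjugate under \<open>U\<close> as soon as they satisfy the same monic equation of degree \<open>n\<close>, and only
  polynomials in them commute with them. Hence \<open>g = u z\<close> with \<open>z\<close> a polynomial in \<open>B\<close>, and
  \<open>sigma z\<close> is the same polynomial in \<open>sigma B\<close>, which is \<open>U\<close>-conjugate to \<open>B\<close>.
\<close>

section \<open>Gelfand's criterion\<close>

text \<open>It is never decided for an arbitrary \<open>g\<close> whether \<open>sigma g\<close>
  lies in the double coset of \<open>g\<close>. For each \<open>g\<close> one of two things
  suffices: every equivariant function vanishes at both \<open>g\<close> and \<open>sigma g\<close>,
  or \<open>sigma g\<close> is reached from \<open>g\<close> by factors in \<open>UTn n\<close>
  whose \<open>theta\<close> values cancel. The test that separates the cases is linear, because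
  \<open>u - 1\<close> runs through the whole module of strictly upper triangular matrices, so
  comparing \<open>theta\<close> on \<open>U\<close> with \<open>theta\<close> on its conjugate by
  \<open>g\<close> means comparing two linear functionals. If they agree, J - g J g^-1 splits as X +
  g Y g^-1 with X and Y upper triangular, and moving terms across gives (J - X) g = g (J + Y). This
  is the origin of the Hessenberg matrices. Their common subdiagonal consists of units, so a cyclic
  vector is available without dividing by anything but units, and the conjugating matrix comes out
  unipotent. Primitivity enters twice: it makes those entries units, and it makes the trace pairing
  perfect over a ring with nilpotents.\<close>

definition lincomb_vec :: "nat \<Rightarrow> 'i set \<Rightarrow> ('i \<Rightarrow> complex) \<Rightarrow> ('i \<Rightarrow> complex vec) \<Rightarrow> complex vec" where
  "lincomb_vec d S c x = vec d (\<lambda>i. \<Sum>g\<in>S. c g * x g $ i)"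

lemma lincomb_vec_carrier [simp]: "lincomb_vec d S c x \<in> carrier_vec d"
  and dim_lincomb_vec [simp]: "dim_vec (lincomb_vec d S c x) = d"
  and index_lincomb_vec [simp]: "i < d \<Longrightarrow> lincomb_vec d S c x $ i = (\<Sum>g\<in>S. c g * x g $ i)"
  by (simp_all add: lincomb_vec_def)

definition linear_functional :: "nat \<Rightarrow> (complex vec \<Rightarrow> complex) \<Rightarrow> bool" where
  "linear_functional d f \<longleftrightarrow>
     (\<forall>v\<in>carrier_vec d. \<forall>w\<in>carrier_vec d. f (v + w) = f v + f w) \<and>
     (\<forall>c. \<forall>v\<in>carrier_vec d. f (c \<cdot>\<^sub>v v) = c * f v)"

lemma linear_functional_zero: "linear_functional d f \<Longrightarrow> f (0\<^sub>v d) = 0"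
proof -
  assume f: "linear_functional d f"
  have "f (0 \<cdot>\<^sub>v 0\<^sub>v d) = 0 * f (0\<^sub>v d)"
    using f unfolding linear_functional_def by (metis zero_carrier_vec)
  moreover have "0 \<cdot>\<^sub>v 0\<^sub>v d = (0\<^sub>v d :: complex vec)" by (intro eq_vecI) auto
  ultimately show ?thesis by simp
qed

lemma linear_functional_lincomb:
  assumes f: "linear_functional d f" and "finite S" and "\<And>g. g \<in> S \<Longrightarrow> x g \<in> carrier_vec d"
  shows "f (lincomb_vec d S c x) = (\<Sum>g\<in>S. c g * f (x g))"
  using assms(2,3)
proof (induction S rule: finite_induct)
  case empty
  have "lincomb_vec d {} c x = 0\<^sub>v d" by (intro eq_vecI) auto
  then show ?case by (simp add: linear_functional_zero[OF f])
next
  case (insert s S)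
  have "lincomb_vec d (insert s S) c x = c s \<cdot>\<^sub>v x s + lincomb_vec d S c x"
    using insert.hyps insert.prems[of s] by (intro eq_vecI) auto
  then show ?case using insert f by (auto simp: linear_functional_def)
qed

lemma mult_mat_lincomb_vec:
  assumes M: "M \<in> carrier_mat d d" and "\<And>g. g \<in> S \<Longrightarrow> x g \<in> carrier_vec d"
  shows "M *\<^sub>v lincomb_vec d S c x = lincomb_vec d S c (\<lambda>g. M *\<^sub>v x g)"
proof (intro eq_vecI)
  fix i assume "i < dim_vec (lincomb_vec d S c (\<lambda>g. M *\<^sub>v x g))"
  then have i: "i < d" by simp
  have "(M *\<^sub>v lincomb_vec d S c x) $ i = (\<Sum>j<d. M $$ (i,j) * (\<Sum>g\<in>S. c g * x g $ j))"
    using M i by (simp add: scalar_prod_def atLeast0LessThan)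
  also have "\<dots> = (\<Sum>g\<in>S. c g * (\<Sum>j<d. M $$ (i,j) * x g $ j))"
    by (simp add: sum_distrib_left, subst sum.swap) (simp add: algebra_simps)
  also have "\<dots> = (\<Sum>g\<in>S. c g * (M *\<^sub>v x g) $ i)"
  proof (intro sum.cong refl)
    fix g assume "g \<in> S"
    then have "dim_vec (x g) = d" using assms(2) by auto
    then show "c g * (\<Sum>j<d. M $$ (i,j) * x g $ j) = c g * (M *\<^sub>v x g) $ i"
      using M i by (simp add: scalar_prod_def atLeast0LessThan)
  qed
  finally show "(M *\<^sub>v lincomb_vec d S c x) $ i = lincomb_vec d S c (\<lambda>g. M *\<^sub>v x g) $ i"
    using i by simp
qed (use M in auto)

text \<open>The functions quantified over in \<open>sigma_invariant\<close> form, under convolution,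
  the Hecke algebra of \<open>theta\<close>. An anti-automorphism acting trivially on it forces
  commutativity. The argument below uses the matrix coefficients of one irreducible representation,
  which lie in this space, in place of the algebra itself.\<close>

locale gelfand_data =
  fixes n :: nat and G U :: "'r::comm_ring_1 mat set" and theta :: "'r mat \<Rightarrow> complex"
    and sigma :: "'r mat \<Rightarrow> 'r mat"
  assumes finite_G: "finite G"
    and G_carrier: "G \<subseteq> carrier_mat n n"
    and G_one: "1\<^sub>m n \<in> G"
    and G_mult: "\<And>g h. g \<in> G \<Longrightarrow> h \<in> G \<Longrightarrow> g * h \<in> G"
    and G_inv: "\<And>g. g \<in> G \<Longrightarrow> \<exists>h\<in>G. g * h = 1\<^sub>m n \<and> h * g = 1\<^sub>m n"
    and U_sub: "U \<subseteq> G"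
    and U_one: "1\<^sub>m n \<in> U"
    and U_mult: "\<And>u v. u \<in> U \<Longrightarrow> v \<in> U \<Longrightarrow> u * v \<in> U"
    and U_inv: "\<And>u. u \<in> U \<Longrightarrow> \<exists>v\<in>U. u * v = 1\<^sub>m n \<and> v * u = 1\<^sub>m n"
    and theta_mult: "\<And>u v. u \<in> U \<Longrightarrow> v \<in> U \<Longrightarrow> theta (u * v) = theta u * theta v"
    and theta_nz: "\<And>u. u \<in> U \<Longrightarrow> theta u \<noteq> 0"
    and sigma_image: "sigma ` G = G"
    and sigma_mult: "\<And>g h. g \<in> G \<Longrightarrow> h \<in> G \<Longrightarrow> sigma (g * h) = sigma h * sigma g"
    and sigma_invariant: "\<And>f g. g \<in> G \<Longrightarrow>
          (\<And>u g. u \<in> U \<Longrightarrow> g \<in> G \<Longrightarrow> f (u * g) = theta u * f g) \<Longrightarrow>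
          (\<And>u g. u \<in> U \<Longrightarrow> g \<in> G \<Longrightarrow> f (g * u) = theta u * f g) \<Longrightarrow> f (sigma g) = (f g :: complex)"
begin

lemma G_assoc: "g \<in> G \<Longrightarrow> h \<in> G \<Longrightarrow> k \<in> G \<Longrightarrow> g * h * k = g * (h * k)"
  using G_carrier by (meson assoc_mult_mat subset_iff)

lemma G_left_one: "g \<in> G \<Longrightarrow> 1\<^sub>m n * g = g" and G_right_one: "g \<in> G \<Longrightarrow> g * 1\<^sub>m n = g"
  using G_carrier by auto

lemma bij_betw_left_mult:
  assumes H: "H \<subseteq> G" "1\<^sub>m n \<in> H" "\<And>g h. g \<in> H \<Longrightarrow> h \<in> H \<Longrightarrow> g * h \<in> H"
    and g: "g \<in> H" "h \<in> H" "g * h = 1\<^sub>m n" "h * g = 1\<^sub>m n"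
  shows "bij_betw ((*) g) H H"
proof (rule bij_betwI[where g = "(*) h"])
  show "h * (g * x) = x" if "x \<in> H" for x
    using that g H(1) G_assoc[of h g x] G_left_one by (metis subset_iff)
  show "g * (h * x) = x" if "x \<in> H" for x
    using that g H(1) G_assoc[of g h x] G_left_one by (metis subset_iff)
qed (use H g in auto)

end

section \<open>Irreducible representations as modules over the group algebra\<close>

locale gelfand_rep = gelfand_data n G U theta sigma
  for n :: nat and G U :: "'r::comm_ring_1 mat set" and theta :: "'r mat \<Rightarrow> complex"
    and sigma :: "'r mat \<Rightarrow> 'r mat" +
  fixes d :: nat and rho :: "'r mat \<Rightarrow> complex mat"
  assumes irred: "irreducible_rep n G d rho"
begin

lemma rho_carrier: "g \<in> G \<Longrightarrow> rho g \<in> carrier_mat d d"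
  and rho_one: "rho (1\<^sub>m n) = 1\<^sub>m d"
  and rho_mult: "g \<in> G \<Longrightarrow> h \<in> G \<Longrightarrow> rho (g * h) = rho g * rho h"
  and d_pos: "d > 0"
  using irred by (auto simp: irreducible_rep_def is_rep_def)

lemma rho_vec_carrier [simp]: "g \<in> G \<Longrightarrow> v \<in> carrier_vec d \<Longrightarrow> rho g *\<^sub>v v \<in> carrier_vec d"
  using rho_carrier by (meson mult_mat_vec_carrier)

lemma rho_mult_vec: "g \<in> G \<Longrightarrow> h \<in> G \<Longrightarrow> v \<in> carrier_vec d \<Longrightarrow>
    rho g *\<^sub>v (rho h *\<^sub>v v) = rho (g * h) *\<^sub>v v"
  by (simp add: rho_mult assoc_mult_mat_vec[OF rho_carrier rho_carrier])

lemma rho_add: "g \<in> G \<Longrightarrow> v \<in> carrier_vec d \<Longrightarrow> w \<in> carrier_vec d \<Longrightarrow>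
    rho g *\<^sub>v (v + w) = rho g *\<^sub>v v + rho g *\<^sub>v w"
  using rho_carrier by (meson mult_add_distrib_mat_vec)

lemma rho_smult: "g \<in> G \<Longrightarrow> v \<in> carrier_vec d \<Longrightarrow> rho g *\<^sub>v (c \<cdot>\<^sub>v v) = c \<cdot>\<^sub>v (rho g *\<^sub>v v)"
  using rho_carrier by (meson mult_mat_vec)

text \<open>The action of the group algebra element with coefficients \<open>F\<close>.\<close>

definition act :: "('r mat \<Rightarrow> complex) \<Rightarrow> complex vec \<Rightarrow> complex vec" where
  "act F w = lincomb_vec d G F (\<lambda>g. rho g *\<^sub>v w)"

lemma act_carrier [simp]: "act F w \<in> carrier_vec d"
  and dim_act [simp]: "dim_vec (act F w) = d"
  by (simp_all add: act_def)

lemma rho_act: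
  assumes "g \<in> G" "w \<in> carrier_vec d"
  shows "rho g *\<^sub>v act F w = lincomb_vec d G F (\<lambda>h. rho (g * h) *\<^sub>v w)"
proof -
  have "rho g *\<^sub>v act F w = lincomb_vec d G F (\<lambda>h. rho g *\<^sub>v (rho h *\<^sub>v w))"
    unfolding act_def by (rule mult_mat_lincomb_vec) (use assms rho_carrier in auto)
  also have "\<dots> = lincomb_vec d G F (\<lambda>h. rho (g * h) *\<^sub>v w)"
    using assms by (simp add: lincomb_vec_def rho_mult_vec)
  finally show ?thesis .
qed

text \<open>The vectors \<open>act F w\<close> form an invariant subspace containing
  \<open>w\<close>, so irreducibility makes it the whole space.\<close>

lemma act_surj:
  assumes w: "w \<in> carrier_vec d" "w \<noteq> 0\<^sub>v d" and v: "v \<in> carrier_vec d"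
  obtains F where "v = act F w"
proof -
  define W where "W = range (\<lambda>F. act F w)"
  have "is_subspace d W"
    unfolding is_subspace_def
  proof (intro conjI ballI allI)
    show "0\<^sub>v d \<in> W" unfolding W_def
      by (rule range_eqI[where x = "\<lambda>_. 0"]) (intro eq_vecI, auto simp: act_def)
    fix x assume "x \<in> W"
    then obtain F where F: "x = act F w" by (auto simp: W_def)
    show "c \<cdot>\<^sub>v x \<in> W" for c unfolding W_def
      by (rule range_eqI[where x = "\<lambda>g. c * F g"])
        (intro eq_vecI, auto simp: act_def F sum_distrib_left mult.assoc)
    fix y assume "y \<in> W"
    then obtain F' where F': "y = act F' w" by (auto simp: W_def)
    show "x + y \<in> W" unfolding W_def
      by (rule range_eqI[where x = "\<lambda>g. F g + F' g"])
        (intro eq_vecI, auto simp: act_def F F' sum.distrib distrib_right)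
  qed (auto simp: W_def)
  moreover have "rho g *\<^sub>v x \<in> W" if g: "g \<in> G" and "x \<in> W" for g x
  proof -
    obtain F where F: "x = act F w" using \<open>x \<in> W\<close> by (auto simp: W_def)
    obtain h where h: "h \<in> G" "g * h = 1\<^sub>m n" "h * g = 1\<^sub>m n" using G_inv[OF g] by auto
    have bij: "bij_betw ((*) g) G G" by (rule bij_betw_left_mult) (use g h G_one G_mult in auto)
    have inv: "h * (g * k) = k" if "k \<in> G" for k
      using that g h G_assoc[of h g k] G_left_one by metis
    \<comment> \<open>Left translation by \<open>g\<close> permutes \<open>G\<close>, so acting by
      \<open>g\<close> only shifts the coefficient function.\<close>
    have "rho g *\<^sub>v x = act (\<lambda>k. F (h * k)) w"
      unfolding F rho_act[OF g w(1)]
    proof (intro eq_vecI)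
      fix i assume "i < dim_vec (act (\<lambda>k. F (h * k)) w)"
      then have i: "i < d" by (simp add: act_def)
      have "(\<Sum>k\<in>G. F k * (rho (g * k) *\<^sub>v w) $ i)
          = (\<Sum>k\<in>G. F (h * (g * k)) * (rho (g * k) *\<^sub>v w) $ i)"
        by (simp add: inv)
      also have "\<dots> = (\<Sum>k\<in>G. F (h * k) * (rho k *\<^sub>v w) $ i)"
        by (rule sum.reindex_bij_betw[OF bij, where g = "\<lambda>k. F (h * k) * (rho k *\<^sub>v w) $ i"])
      finally show "lincomb_vec d G F (\<lambda>k. rho (g * k) *\<^sub>v w) $ i = act (\<lambda>k. F (h * k)) w $ i"
        using i by (simp add: act_def)
    qed (simp add: act_def)
    then show ?thesis by (simp add: W_def)
  qed
  ultimately have "W = {0\<^sub>v d} \<or> W = carrier_vec d"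
    using irred unfolding irreducible_rep_def by blast
  moreover have "w = act (\<lambda>g. if g = 1\<^sub>m n then 1 else 0) w"
    using w finite_G G_one
    by (intro eq_vecI) (auto simp: act_def if_distrib[of "\<lambda>c. c * _"] rho_one cong: if_cong)
  then have "w \<in> W" by (auto simp: W_def)
  ultimately show thesis using v w(2) that by (auto simp: W_def)
qed

text \<open>Serves as irreducibility of the dual: the vectors whose whole orbit lies in the kernel
  of \<open>lam\<close> form an invariant subspace, and it misses \<open>v0\<close>.\<close>

lemma functional_faithful:
  assumes lam: "linear_functional d lam" and nz: "v0 \<in> carrier_vec d" "lam v0 \<noteq> 0"
    and v: "v \<in> carrier_vec d" "\<And>g. g \<in> G \<Longrightarrow> lam (rho g *\<^sub>v v) = 0"
  shows "v = 0\<^sub>v d"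
proof -
  have lam_add: "lam (x + y) = lam x + lam y" if "x \<in> carrier_vec d" "y \<in> carrier_vec d" for x y
    using lam that by (simp add: linear_functional_def)
  have lam_smult: "lam (c \<cdot>\<^sub>v x) = c * lam x" if "x \<in> carrier_vec d" for c x
    using lam that by (simp add: linear_functional_def)
  define W where "W = {x \<in> carrier_vec d. \<forall>g\<in>G. lam (rho g *\<^sub>v x) = 0}"
  have "rho g *\<^sub>v 0\<^sub>v d = 0\<^sub>v d" if "g \<in> G" for g
    using rho_carrier[OF that] by (intro eq_vecI) auto
  then have "is_subspace d W"
    using linear_functional_zero[OF lam]
    by (auto simp: is_subspace_def W_def rho_add rho_smult lam_add lam_smult)
  moreover have "\<forall>g\<in>G. \<forall>x\<in>W. rho g *\<^sub>v x \<in> W"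
    by (auto simp: W_def rho_mult_vec G_mult)
  ultimately have "W = {0\<^sub>v d} \<or> W = carrier_vec d"
    using irred unfolding irreducible_rep_def by blast
  moreover have "v0 \<notin> W"
    using nz G_one by (auto simp: W_def rho_one intro!: bexI[of _ "1\<^sub>m n"])
  moreover have "v \<in> W" using v by (simp add: W_def)
  ultimately show ?thesis using nz by auto
qed

section \<open>Whittaker functionals and Whittaker vectors\<close>

definition whittaker_functional :: "(complex vec \<Rightarrow> complex) \<Rightarrow> bool" where
  "whittaker_functional lam \<longleftrightarrow> linear_functional d lam \<and>
     (\<forall>u\<in>U. \<forall>v\<in>carrier_vec d. lam (rho u *\<^sub>v v) = theta u * lam v)"

definition whittaker_vector :: "complex vec \<Rightarrow> bool" where
  "whittaker_vector w \<longleftrightarrow> w \<in> carrier_vec d \<and> (\<forall>u\<in>U. rho u *\<^sub>v w = theta u \<cdot>\<^sub>v w)"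

text \<open>The matrix coefficient of \<open>lam\<close> and \<open>w\<close> transforms by
  \<open>theta\<close> on both sides, so \<open>sigma\<close> leaves it unchanged. Reversing the
  product moves \<open>g\<close> next to \<open>w\<close> and leaves \<open>F\<close> to act on the
  side of the functional.\<close>

lemma functional_act_sigma:
  assumes lam: "whittaker_functional lam" and w: "whittaker_vector w" and g: "g \<in> G"
  shows "lam (rho g *\<^sub>v act F w) = (\<Sum>h\<in>G. F h * lam (rho (sigma h) *\<^sub>v (rho (sigma g) *\<^sub>v w)))"
proof -
  have wc: "w \<in> carrier_vec d" using w by (simp add: whittaker_vector_def)
  have lin: "linear_functional d lam" using lam by (simp add: whittaker_functional_def)
  have sigma_G: "sigma x \<in> G" if "x \<in> G" for x using that sigma_image by blast
  have inv: "lam (rho (sigma x) *\<^sub>v w) = lam (rho x *\<^sub>v w)" if "x \<in> G" for x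
  proof (rule sigma_invariant[OF that])
    fix u k assume uk: "u \<in> U" "k \<in> G"
    then have u: "u \<in> G" using U_sub by auto
    show "lam (rho (u * k) *\<^sub>v w) = theta u * lam (rho k *\<^sub>v w)"
      using uk u wc lam by (simp add: rho_mult_vec[symmetric] whittaker_functional_def)
    show "lam (rho (k * u) *\<^sub>v w) = theta u * lam (rho k *\<^sub>v w)"
      using uk u wc w lin
      by (simp add: rho_mult_vec[symmetric] whittaker_vector_def rho_smult linear_functional_def)
  qed
  have "lam (rho g *\<^sub>v act F w) = (\<Sum>h\<in>G. F h * lam (rho (g * h) *\<^sub>v w))"
    unfolding rho_act[OF g wc]
    by (rule linear_functional_lincomb[OF lin finite_G]) (use g wc G_mult in auto)
  also have "\<dots> = (\<Sum>h\<in>G. F h * lam (rho (sigma h) *\<^sub>v (rho (sigma g) *\<^sub>v w)))"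
    using g wc
    by (intro sum.cong refl) (metis inv G_mult sigma_mult rho_mult_vec sigma_G)
  finally show ?thesis .
qed

text \<open>The relations \<open>act F w = 0\<close> can be read off from \<open>lam\<close> alone, as
  \<open>\<Sum>h. F h * lam (rho (sigma h) v) = 0\<close> for all \<open>v\<close>; hence they are the same for all nonzero
  Whittaker vectors \<open>w\<close>.\<close>
lemma annihilator_whittaker:
  assumes lam: "whittaker_functional lam" and nz: "v0 \<in> carrier_vec d" "lam v0 \<noteq> 0"
    and w: "whittaker_vector w" and w': "whittaker_vector w'" "w' \<noteq> 0\<^sub>v d"
    and F: "act F w' = 0\<^sub>v d"
  shows "act F w = 0\<^sub>v d"
proof -
  have lin: "linear_functional d lam" using lam by (simp add: whittaker_functional_def)
  have wc: "w \<in> carrier_vec d" "w' \<in> carrier_vec d" using w w' by (auto simp: whittaker_vector_def)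
  have sigma_G: "sigma x \<in> G" if "x \<in> G" for x using that sigma_image by blast
  have rho_zero: "rho g *\<^sub>v 0\<^sub>v d = 0\<^sub>v d" if "g \<in> G" for g
    using rho_carrier[OF that] by (intro eq_vecI) auto
  \<comment> \<open>Every \<open>g\<close> has the form \<open>sigma k\<close>, so the relations
    coming from \<open>rho k *\<^sub>v act F w' = 0\<close> reach the whole orbit of
    \<open>w'\<close>.\<close>
  have orbit: "(\<Sum>h\<in>G. F h * lam (rho (sigma h) *\<^sub>v (rho g *\<^sub>v w'))) = 0" if "g \<in> G" for g
  proof -
    have "g \<in> sigma ` G" using that by (simp only: sigma_image)
    then obtain k where k: "k \<in> G" "g = sigma k" by (rule imageE)
    then show ?thesis
      using functional_act_sigma[OF lam w'(1) k(1), of F] F rho_zero[OF k(1)]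
        linear_functional_zero[OF lin] by simp
  qed
  \<comment> \<open>\<open>w'\<close> is cyclic, so a relation that holds along its orbit extends
    linearly to all vectors.\<close>
  have all: "(\<Sum>h\<in>G. F h * lam (rho (sigma h) *\<^sub>v v)) = 0" if v: "v \<in> carrier_vec d" for v
  proof -
    obtain H where H: "v = act H w'" using act_surj[OF wc(2) w'(2) v] .
    have "lam (rho x *\<^sub>v v) = (\<Sum>g\<in>G. H g * lam (rho x *\<^sub>v (rho g *\<^sub>v w')))" if "x \<in> G" for x
      unfolding H rho_act[OF that wc(2)]
      by (subst linear_functional_lincomb[OF lin finite_G]) (use that wc G_mult in \<open>auto simp: rho_mult_vec\<close>)
    then have "(\<Sum>h\<in>G. F h * lam (rho (sigma h) *\<^sub>v v))
        = (\<Sum>h\<in>G. \<Sum>g\<in>G. H g * (F h * lam (rho (sigma h) *\<^sub>v (rho g *\<^sub>v w'))))"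
      by (simp add: sigma_G sum_distrib_left algebra_simps)
    also have "\<dots> = (\<Sum>g\<in>G. H g * (\<Sum>h\<in>G. F h * lam (rho (sigma h) *\<^sub>v (rho g *\<^sub>v w'))))"
      by (subst sum.swap) (simp add: sum_distrib_left)
    finally show ?thesis by (simp add: orbit)
  qed
  show ?thesis
    by (rule functional_faithful[OF lin nz act_carrier])
      (simp add: functional_act_sigma[OF lam w] all sigma_G wc)
qed

text \<open>The coefficient functions \<open>F j\<close> send \<open>w1\<close> to the standard basis. An eigenvector \<open>x\<close> of the matrix
  with columns \<open>act (F j) w2\<close> gives an element that kills \<open>w2 - c w1\<close> but not \<open>w1\<close>.\<close>
lemma whittaker_vectors_proportional:
  assumes lam: "whittaker_functional lam" and nz: "v0 \<in> carrier_vec d" "lam v0 \<noteq> 0"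
    and w1: "whittaker_vector w1" "w1 \<noteq> 0\<^sub>v d" and w2: "whittaker_vector w2"
  obtains c where "w2 = c \<cdot>\<^sub>v w1"
proof -
  have wc: "w1 \<in> carrier_vec d" "w2 \<in> carrier_vec d" using w1 w2 by (auto simp: whittaker_vector_def)
  have "\<exists>F. act F w1 = unit_vec d j" for j
    using act_surj[OF wc(1) w1(2), of "unit_vec d j"] by (metis unit_vec_carrier)
  then obtain F where F: "\<And>j. act (F j) w1 = unit_vec d j" by metis
  define L where "L = mat d d (\<lambda>(i,j). act (F j) w2 $ i)"
  have L: "L \<in> carrier_mat d d" by (simp add: L_def)
  \<comment> \<open>As in Schur's lemma, an eigenvector exists because the complex field is
    algebraically closed and \<open>d\<close> is positive.\<close>
  obtain c x where x: "eigenvector L x c"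
    using spectrum_non_empty[OF L d_pos] by (auto simp: spectrum_def eigenvalue_def)
  then have xc: "x \<in> carrier_vec d" and x0: "x \<noteq> 0\<^sub>v d" and Lx: "L *\<^sub>v x = c \<cdot>\<^sub>v x"
    using L by (auto simp: eigenvector_def)
  define H where "H = (\<lambda>g. \<Sum>j<d. x $ j * F j g)"
  have act_H: "act H w $ i = (\<Sum>j<d. x $ j * act (F j) w $ i)" if i: "i < d" for w i
  proof -
    have "act H w $ i = (\<Sum>g\<in>G. \<Sum>j<d. x $ j * (F j g * (rho g *\<^sub>v w) $ i))"
      using i by (simp add: act_def H_def sum_distrib_right mult.assoc)
    also have "\<dots> = (\<Sum>j<d. x $ j * act (F j) w $ i)"
      by (subst sum.swap) (use i in \<open>simp add: act_def sum_distrib_left\<close>)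
    finally show ?thesis .
  qed
  have Hw1: "act H w1 = x"
  proof (intro eq_vecI)
    fix i assume "i < dim_vec x"
    then have i: "i < d" using xc by simp
    have "act H w1 $ i = (\<Sum>j<d. if i = j then x $ j else 0)"
      using i by (simp add: act_H F if_distrib[of "(*) _"] cong: if_cong)
    then show "act H w1 $ i = x $ i" using i by simp
  qed (use xc in simp)
  have Hw2: "act H w2 = c \<cdot>\<^sub>v x"
    unfolding Lx[symmetric]
    using xc by (intro eq_vecI) (simp_all add: L_def scalar_prod_def atLeast0LessThan act_H mult.commute)
  define w where "w = w2 + (- c) \<cdot>\<^sub>v w1"
  have w: "whittaker_vector w"
    using w1 w2 U_sub by (auto simp: whittaker_vector_def w_def rho_add rho_smult subset_iff
        smult_add_distrib_vec[of _ d] smult_smult_assoc mult.commute)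
  have "act H w = act H w2 + (- c) \<cdot>\<^sub>v act H w1"
  proof (intro eq_vecI)
    fix i assume "i < dim_vec (act H w2 + (- c) \<cdot>\<^sub>v act H w1)"
    then have i: "i < d" by (simp add: act_def)
    have "(rho g *\<^sub>v w) $ i = (rho g *\<^sub>v w2) $ i + (- c) * (rho g *\<^sub>v w1) $ i" if "g \<in> G" for g
      using that wc i rho_carrier[OF that] by (simp add: w_def rho_add rho_smult del: index_mult_mat_vec)
    then have "act H w $ i
        = (\<Sum>g\<in>G. H g * (rho g *\<^sub>v w2) $ i + (- c) * (H g * (rho g *\<^sub>v w1) $ i))"
      using i by (simp add: act_def distrib_left right_diff_distrib mult.left_commute)
    then show "act H w $ i = (act H w2 + (- c) \<cdot>\<^sub>v act H w1) $ i"
      using i by (simp add: act_def sum_subtractf sum_distrib_left sum_negf)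
  qed (simp add: act_def)
  also have "\<dots> = 0\<^sub>v d" unfolding Hw1 Hw2 using xc by (intro eq_vecI) auto
  finally have Hw: "act H w = 0\<^sub>v d" .
  \<comment> \<open>Were \<open>w\<close> nonzero, \<open>H\<close> would annihilate
    \<open>w1\<close> along with it, yet \<open>act H w1\<close> is the eigenvector
    \<open>x\<close>.\<close>
  have "w = 0\<^sub>v d"
    using annihilator_whittaker[OF lam nz w1(1) w _ Hw] Hw1 x0 by auto
  then have "w2 = c \<cdot>\<^sub>v w1"
  proof -
    assume w0: "w = 0\<^sub>v d"
    show ?thesis
    proof (intro eq_vecI)
      fix i assume "i < dim_vec (c \<cdot>\<^sub>v w1)"
      then have "i < d" using wc by simp
      then have "w $ i = w2 $ i - c * w1 $ i" using wc by (simp add: w_def)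
      then show "w2 $ i = (c \<cdot>\<^sub>v w1) $ i" using w0 \<open>i < d\<close> wc by simp
    qed (use wc in simp)
  qed
  then show thesis by (rule that)
qed

text \<open>The projection onto the Whittaker vectors, multiplied by \<open>card U\<close>.\<close>

definition whittaker_sum :: "complex vec \<Rightarrow> complex vec" where
  "whittaker_sum v = lincomb_vec d U (\<lambda>u. inverse (theta u)) (\<lambda>u. rho u *\<^sub>v v)"

lemma finite_U: "finite U"
  using U_sub finite_G by (rule finite_subset)

lemma whittaker_vector_sum:
  assumes v: "v \<in> carrier_vec d"
  shows "whittaker_vector (whittaker_sum v)"
  unfolding whittaker_vector_def
proof (intro conjI ballI)
  fix u assume u: "u \<in> U"
  obtain u' where u': "u' \<in> U" "u * u' = 1\<^sub>m n" "u' * u = 1\<^sub>m n" using U_inv[OF u] by auto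
  have UG: "\<And>x. x \<in> U \<Longrightarrow> x \<in> G" using U_sub by auto
  have bij: "bij_betw ((*) u) U U"
    by (rule bij_betw_left_mult) (use u u' U_one U_mult U_sub in auto)
  have "rho u *\<^sub>v whittaker_sum v
      = lincomb_vec d U (\<lambda>x. inverse (theta x)) (\<lambda>x. rho u *\<^sub>v (rho x *\<^sub>v v))"
    unfolding whittaker_sum_def by (rule mult_mat_lincomb_vec) (use u v UG rho_carrier in auto)
  also have "\<dots> = theta u \<cdot>\<^sub>v whittaker_sum v"
  proof (intro eq_vecI)
    fix i assume "i < dim_vec (theta u \<cdot>\<^sub>v whittaker_sum v)"
    then have i: "i < d" by (simp add: whittaker_sum_def)
    have "(\<Sum>x\<in>U. inverse (theta x) * (rho u *\<^sub>v (rho x *\<^sub>v v)) $ i)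
        = (\<Sum>x\<in>U. theta u * (inverse (theta (u * x)) * (rho (u * x) *\<^sub>v v) $ i))"
      using u v UG theta_nz by (intro sum.cong refl) (simp add: rho_mult_vec theta_mult)
    also have "\<dots> = (\<Sum>x\<in>U. theta u * (inverse (theta x) * (rho x *\<^sub>v v) $ i))"
      by (rule sum.reindex_bij_betw[OF bij,
            where g = "\<lambda>x. theta u * (inverse (theta x) * (rho x *\<^sub>v v) $ i)"])
    finally show "lincomb_vec d U (\<lambda>x. inverse (theta x)) (\<lambda>x. rho u *\<^sub>v (rho x *\<^sub>v v)) $ i
        = (theta u \<cdot>\<^sub>v whittaker_sum v) $ i"
      using i by (simp add: whittaker_sum_def sum_distrib_left)
  qed (simp add: whittaker_sum_def)
  finally show "rho u *\<^sub>v whittaker_sum v = theta u \<cdot>\<^sub>v whittaker_sum v" .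
qed (simp add: whittaker_sum_def)

lemma whittaker_functional_sum:
  assumes lam: "whittaker_functional lam" and v: "v \<in> carrier_vec d"
  shows "lam (whittaker_sum v) = of_nat (card U) * lam v"
proof -
  have lin: "linear_functional d lam" using lam by (simp add: whittaker_functional_def)
  have "lam (whittaker_sum v) = (\<Sum>u\<in>U. inverse (theta u) * lam (rho u *\<^sub>v v))"
    unfolding whittaker_sum_def
    by (rule linear_functional_lincomb[OF lin finite_U]) (use U_sub v in auto)
  also have "\<dots> = (\<Sum>u\<in>U. lam v)"
    using lam v theta_nz by (intro sum.cong refl) (simp add: whittaker_functional_def)
  finally show ?thesis by simp
qed

text \<open>By \<open>whittaker_functional_sum\<close>, a Whittaker functional is determined by its
  values on Whittaker vectors. As soon as one such functional is nonzero these vectors form a line,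
  which leaves a single degree of freedom.\<close>

lemma whittaker_functionals_dependent:
  assumes lam: "whittaker_functional lam1" "whittaker_functional lam2"
  shows "\<exists>c1 c2. (c1 \<noteq> 0 \<or> c2 \<noteq> 0) \<and> (\<forall>v\<in>carrier_vec d. c1 * lam1 v + c2 * lam2 v = 0)"
proof (cases "\<exists>v\<in>carrier_vec d. lam1 v \<noteq> 0")
  case False
  then show ?thesis by (intro exI[of _ 1] exI[of _ 0]) auto
next
  case True
  then obtain v0 where v0: "v0 \<in> carrier_vec d" "lam1 v0 \<noteq> 0" by auto
  have lin: "linear_functional d lam1" "linear_functional d lam2"
    using lam by (auto simp: whittaker_functional_def)
  have cardU: "card U \<noteq> 0" using finite_U U_one by auto
  let ?w = "whittaker_sum v0"
  have wc: "?w \<in> carrier_vec d" by (simp add: whittaker_sum_def)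
  have w1: "lam1 ?w \<noteq> 0" using whittaker_functional_sum[OF lam(1) v0(1)] cardU v0 by simp
  then have w0: "?w \<noteq> 0\<^sub>v d" using linear_functional_zero[OF lin(1)] by auto
  \<comment> \<open>The combination is the one that vanishes at \<open>?w\<close>; its second
    coefficient is nonzero.\<close>
  have "lam2 ?w * lam1 v + (- lam1 ?w) * lam2 v = 0" if v: "v \<in> carrier_vec d" for v
  proof -
    obtain c where c: "whittaker_sum v = c \<cdot>\<^sub>v ?w"
      using whittaker_vectors_proportional[OF lam(1) v0 whittaker_vector_sum[OF v0(1)] w0
          whittaker_vector_sum[OF v]] .
    have "of_nat (card U) * lam1 v = c * lam1 ?w" "of_nat (card U) * lam2 v = c * lam2 ?w"
      using whittaker_functional_sum[OF lam(1) v] whittaker_functional_sum[OF lam(2) v] lin wc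
      by (auto simp: c linear_functional_def)
    then have "of_nat (card U) * (lam2 ?w * lam1 v + (- lam1 ?w) * lam2 v) = 0"
      by (simp add: distrib_left right_diff_distrib mult.left_commute[of "of_nat (card U)"])
    then show ?thesis using cardU by simp
  qed
  then show ?thesis using w1 by (intro exI[of _ "lam2 ?w"] exI[of _ "- lam1 ?w"]) auto
qed

text \<open>Frobenius reciprocity: evaluation at the identity turns an intertwiner into a Whittaker
  functional, and equivariance recovers all other values from it.\<close>

lemma whittaker_functional_of_intertwiner:
  assumes T: "intertwiner G U theta d rho T"
  shows "whittaker_functional (\<lambda>v. T v (1\<^sub>m n))"
    and "v \<in> carrier_vec d \<Longrightarrow> g \<in> G \<Longrightarrow> T v g = T (rho g *\<^sub>v v) (1\<^sub>m n)"
    and "v \<in> carrier_vec d \<Longrightarrow> g \<notin> G \<Longrightarrow> T v g = 0"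
proof -
  show eval: "T v g = T (rho g *\<^sub>v v) (1\<^sub>m n)" if "v \<in> carrier_vec d" "g \<in> G" for v g
    using T that G_one by (simp add: intertwiner_def ind_action_def G_left_one)
  show "T v g = 0" if "v \<in> carrier_vec d" "g \<notin> G" for v g
    using T that by (auto simp: intertwiner_def ind_space_def)
  have equiv: "T v (u * g) = theta u * T v g" if "v \<in> carrier_vec d" "u \<in> U" "g \<in> G" for v u g
    using T that unfolding intertwiner_def ind_space_def by blast
  have "T (rho u *\<^sub>v v) (1\<^sub>m n) = theta u * T v (1\<^sub>m n)" if "u \<in> U" "v \<in> carrier_vec d" for u v
    using eval[of v u] that U_sub equiv[OF that(2,1) G_one] G_right_one[of u] by auto
  then show "whittaker_functional (\<lambda>v. T v (1\<^sub>m n))"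
    using T by (simp add: whittaker_functional_def linear_functional_def intertwiner_def)
qed

theorem multiplicity_one: "hom_dim_le_1 G U theta d rho"
  unfolding hom_dim_le_1_def
proof (intro allI impI, elim conjE)
  fix T1 T2
  assume T: "intertwiner G U theta d rho T1" "intertwiner G U theta d rho T2"
  obtain c1 c2 where c: "c1 \<noteq> 0 \<or> c2 \<noteq> 0"
    "\<And>v. v \<in> carrier_vec d \<Longrightarrow> c1 * T1 v (1\<^sub>m n) + c2 * T2 v (1\<^sub>m n) = 0"
    using whittaker_functionals_dependent[OF whittaker_functional_of_intertwiner(1)[OF T(1)]
        whittaker_functional_of_intertwiner(1)[OF T(2)]] by blast
  have "c1 * T1 v x + c2 * T2 v x = 0" if v: "v \<in> carrier_vec d" for v x
  proof (cases "x \<in> G")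
    case True
    then show ?thesis
      using whittaker_functional_of_intertwiner(2)[OF T(1) v True]
        whittaker_functional_of_intertwiner(2)[OF T(2) v True] c(2)[of "rho x *\<^sub>v v"] v by simp
  next
    case False
    then show ?thesis using whittaker_functional_of_intertwiner(3)[OF T(1) v False]
        whittaker_functional_of_intertwiner(3)[OF T(2) v False] by simp
  qed
  then show "\<exists>c1 c2. (c1 \<noteq> 0 \<or> c2 \<noteq> 0) \<and>
      (\<forall>v\<in>carrier_vec d. \<forall>x. c1 * T1 v x + c2 * T2 v x = 0)"
    using c(1) by blast
qed

end

section \<open>Hessenberg matrices and Krylov bases\<close>

lemma index_mult_mat_sum:
  "A \<in> carrier_mat m n \<Longrightarrow> B \<in> carrier_mat n k \<Longrightarrow> i < m \<Longrightarrow> j < k \<Longrightarrow>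
    (A * B) $$ (i, j) = (\<Sum>l<n. A $$ (i, l) * B $$ (l, j))"
  by (simp add: scalar_prod_def atLeast0LessThan)

text \<open>The adjugate times the inverse of the determinant is an inverse over any commutative
  ring; its shape is then read off from \<open>M * M' = 1\<^sub>m n\<close>. The diagonal is
  recorded because unipotence of a quotient of two Krylov matrices is later checked there.\<close>

lemma upper_triangular_inverse:
  fixes M :: "'r::comm_ring_1 mat"
  assumes M: "M \<in> carrier_mat n n" and ut: "\<And>i j. i < n \<Longrightarrow> j < i \<Longrightarrow> M $$ (i, j) = 0"
    and t: "\<And>i. i < n \<Longrightarrow> M $$ (i, i) * t i = 1"
  obtains M' where "M' \<in> carrier_mat n n" "M * M' = 1\<^sub>m n" "M' * M = 1\<^sub>m n"
    "\<And>i j. i < n \<Longrightarrow> j < i \<Longrightarrow> M' $$ (i, j) = 0" "\<And>i. i < n \<Longrightarrow> M' $$ (i, i) = t i"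
proof -
  define e where "e = (\<Prod>i<n. t i)"
  define M' where "M' = e \<cdot>\<^sub>m adj_mat M"
  have "upper_triangular M" using M ut by (auto simp: upper_triangular_def)
  then have "det M = (\<Prod>i<n. M $$ (i, i))"
    using det_upper_triangular[of M n] M by (simp add: prod_list_diag_prod atLeast0LessThan)
  then have "det M * e = (\<Prod>i<n. M $$ (i, i) * t i)" by (simp add: e_def prod.distrib)
  then have e: "det M * e = 1" using t by simp
  have M': "M' \<in> carrier_mat n n" using adj_mat(1)[OF M] by (simp add: M'_def)
  have MM': "M * M' = 1\<^sub>m n"
    unfolding M'_def using mult_smult_distrib[OF M adj_mat(1)[OF M]] adj_mat(2)[OF M] e
    by (auto simp: mult.commute)
  have M'M: "M' * M = 1\<^sub>m n"
    unfolding M'_def using mult_smult_assoc_mat[OF adj_mat(1)[OF M] M] adj_mat(3)[OF M] e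
    by (auto simp: mult.commute)
  have cancel: "x = 0" if "i < n" "M $$ (i, i) * x = 0" for i x
    using t[OF that(1)] that(2) by (metis mult.assoc mult.commute mult_1_right mult_zero_right)
  \<comment> \<open>Row \<open>i\<close> of the product involves only rows of \<open>M'\<close> from
    \<open>i\<close> downwards, hence the induction from the bottom row up.\<close>
  have low: "M' $$ (i, j) = 0" if "i < n" "j < i" for i j
    using that
  proof (induction "n - i" arbitrary: i rule: less_induct)
    case less
    have "(\<Sum>l<n. M $$ (i, l) * M' $$ (l, j)) = (\<Sum>l<n. if l = i then M $$ (i, i) * M' $$ (i, j) else 0)"
    proof (intro sum.cong refl)
      fix l assume l: "l \<in> {..<n}"
      show "M $$ (i, l) * M' $$ (l, j) = (if l = i then M $$ (i, i) * M' $$ (i, j) else 0)"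
        using less.prems l ut[of i l] less.hyps[of l] by (cases l i rule: linorder_cases) auto
    qed
    moreover have "(\<Sum>l<n. M $$ (i, l) * M' $$ (l, j)) = 0"
      using index_mult_mat_sum[OF M M', of i j] MM' less.prems by simp
    ultimately show ?case using cancel[of i] less.prems by simp
  qed
  have diag: "M' $$ (i, i) = t i" if i: "i < n" for i
  proof -
    have "(\<Sum>l<n. M $$ (i, l) * M' $$ (l, i)) = (\<Sum>l<n. if l = i then M $$ (i, i) * M' $$ (i, i) else 0)"
    proof (intro sum.cong refl)
      fix l assume l: "l \<in> {..<n}"
      show "M $$ (i, l) * M' $$ (l, i) = (if l = i then M $$ (i, i) * M' $$ (i, i) else 0)"
        using i l ut[of i l] low[of l i] by (cases l i rule: linorder_cases) auto
    qed
    then have "M $$ (i, i) * M' $$ (i, i) = 1"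
      using index_mult_mat_sum[OF M M' i i] MM' i by simp
    then show ?thesis using t[OF i] by (metis mult.assoc mult.commute mult_1_right)
  qed
  show thesis using that[OF M' MM' M'M low diag] .
qed

section \<open>The group of unipotent matrices\<close>

lemma UTn_carrier: "u \<in> UTn n \<Longrightarrow> u \<in> carrier_mat n n"
  and UTn_lower: "u \<in> UTn n \<Longrightarrow> i < n \<Longrightarrow> j < i \<Longrightarrow> u $$ (i, j) = 0"
  and UTn_diag: "u \<in> UTn n \<Longrightarrow> i < n \<Longrightarrow> u $$ (i, i) = 1"
  by (auto simp: UTn_def)

lemma UTnI:
  "u \<in> carrier_mat n n \<Longrightarrow> (\<And>i j. i < n \<Longrightarrow> j < i \<Longrightarrow> u $$ (i, j) = 0) \<Longrightarrow>
    (\<And>i. i < n \<Longrightarrow> u $$ (i, i) = 1) \<Longrightarrow> u \<in> UTn n"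
  by (auto simp: UTn_def)

lemma upper_triangular_mult:
  fixes M N :: "'r::comm_ring_1 mat"
  assumes M: "M \<in> carrier_mat n n" "\<And>i j. i < n \<Longrightarrow> j < i \<Longrightarrow> M $$ (i, j) = 0"
    and N: "N \<in> carrier_mat n n" "\<And>i j. i < n \<Longrightarrow> j < i \<Longrightarrow> N $$ (i, j) = 0"
  shows "i < n \<Longrightarrow> j < i \<Longrightarrow> (M * N) $$ (i, j) = 0"
    and "i < n \<Longrightarrow> (M * N) $$ (i, i) = M $$ (i, i) * N $$ (i, i)"
proof -
  assume i: "i < n"
  have zero: "M $$ (i, l) * N $$ (l, j) = 0" if "l < n" "j \<le> i" "l \<noteq> i \<or> j \<noteq> i" for l j
    using that M(2)[OF i, of l] N(2)[of l j] by (cases l i rule: linorder_cases) auto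
  show "(M * N) $$ (i, j) = 0" if "j < i"
    using i that index_mult_mat_sum[OF M(1) N(1), of i j] zero by (simp add: sum.neutral)
  have "(\<Sum>l<n. M $$ (i, l) * N $$ (l, i)) = (\<Sum>l<n. if l = i then M $$ (i, i) * N $$ (i, i) else 0)"
    by (intro sum.cong refl) (use zero in auto)
  then show "(M * N) $$ (i, i) = M $$ (i, i) * N $$ (i, i)"
    using i index_mult_mat_sum[OF M(1) N(1), of i i] by simp
qed

lemma UTn_one: "1\<^sub>m n \<in> UTn n"
  by (auto simp: UTn_def)

lemma UTn_mult: "u \<in> UTn n \<Longrightarrow> v \<in> UTn n \<Longrightarrow> u * v \<in> UTn n"
proof -
  assume u: "u \<in> UTn n" and v: "v \<in> UTn n"
  note mult = upper_triangular_mult[OF UTn_carrier[OF u] UTn_lower[OF u] UTn_carrier[OF v] UTn_lower[OF v]]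
  show ?thesis
    using mult mult_carrier_mat[OF UTn_carrier[OF u] UTn_carrier[OF v]] UTn_diag[OF u] UTn_diag[OF v]
    by (intro UTnI) (auto simp del: index_mult_mat(1))
qed

lemma UTn_inverse:
  assumes "u \<in> UTn n"
  obtains v where "v \<in> UTn n" "u * v = 1\<^sub>m n" "v * u = 1\<^sub>m n"
proof (rule upper_triangular_inverse[of u n "\<lambda>_. 1"])
  fix v assume v: "v \<in> carrier_mat n n" "u * v = 1\<^sub>m n" "v * u = 1\<^sub>m n"
    "\<And>i j. i < n \<Longrightarrow> j < i \<Longrightarrow> v $$ (i, j) = 0" "\<And>i. i < n \<Longrightarrow> v $$ (i, i) = 1"
  show thesis by (rule that[OF UTnI[OF v(1,4,5)] v(2,3)])
qed (use assms UTn_carrier UTn_lower UTn_diag in auto)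

lemma UTn_det: "u \<in> UTn n \<Longrightarrow> det u = 1"
  using det_upper_triangular[of u n] UTn_carrier[of u n] UTn_lower[of u n] UTn_diag[of u n]
  by (auto simp: upper_triangular_def prod_list_diag_prod)

section \<open>Polynomials in a matrix\<close>

definition mat_poly :: "nat \<Rightarrow> (nat \<Rightarrow> 'r::comm_ring_1) \<Rightarrow> 'r mat \<Rightarrow> 'r mat" where
  "mat_poly n c A = mat n n (\<lambda>(i, j). \<Sum>k<n. c k * (A ^\<^sub>m k) $$ (i, j))"

lemma mat_poly_carrier [simp]: "mat_poly n c A \<in> carrier_mat n n"
  by (simp add: mat_poly_def)

lemma pow_mat_intertwine:
  assumes A: "A \<in> carrier_mat n n" and B: "B \<in> carrier_mat n n" and g: "g \<in> carrier_mat n n"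
    and eq: "A * g = g * B"
  shows "A ^\<^sub>m k * g = g * B ^\<^sub>m k"
proof (induction k)
  case 0
  then show ?case using A B g by simp
next
  case (Suc k)
  have Ak: "A ^\<^sub>m k \<in> carrier_mat n n" and Bk: "B ^\<^sub>m k \<in> carrier_mat n n" using A B by simp_all
  have "A ^\<^sub>m Suc k * g = A ^\<^sub>m k * (A * g)" using assoc_mult_mat[OF Ak A g] by simp
  also have "\<dots> = A ^\<^sub>m k * g * B" using assoc_mult_mat[OF Ak g B] eq by simp
  also have "\<dots> = g * (B ^\<^sub>m k * B)" using assoc_mult_mat[OF g Bk B] Suc by simp
  finally show ?case by simp
qed

lemma mat_poly_intertwine:
  assumes A: "A \<in> carrier_mat n n" and B: "B \<in> carrier_mat n n" and g: "g \<in> carrier_mat n n"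
    and eq: "A * g = g * B"
  shows "mat_poly n c A * g = g * mat_poly n c B"
proof (rule eq_matI)
  fix i j assume "i < dim_row (g * mat_poly n c B)" "j < dim_col (g * mat_poly n c B)"
  then have ij: "i < n" "j < n" using g by (auto simp: mat_poly_def)
  have Ak: "A ^\<^sub>m k \<in> carrier_mat n n" and Bk: "B ^\<^sub>m k \<in> carrier_mat n n" for k
    using A B by simp_all
  have "(mat_poly n c A * g) $$ (i, j) = (\<Sum>l<n. \<Sum>k<n. c k * ((A ^\<^sub>m k) $$ (i, l) * g $$ (l, j)))"
    using ij by (subst index_mult_mat_sum[OF mat_poly_carrier g])
      (auto simp: mat_poly_def sum_distrib_right mult.assoc)
  also have "\<dots> = (\<Sum>k<n. c k * (A ^\<^sub>m k * g) $$ (i, j))"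
    by (subst sum.swap) (simp add: index_mult_mat_sum[OF Ak g ij] sum_distrib_left)
  also have "\<dots> = (\<Sum>k<n. c k * (g * B ^\<^sub>m k) $$ (i, j))"
    by (simp add: pow_mat_intertwine[OF A B g eq])
  also have "\<dots> = (\<Sum>l<n. \<Sum>k<n. g $$ (i, l) * (c k * (B ^\<^sub>m k) $$ (l, j)))"
    by (subst sum.swap) (simp add: index_mult_mat_sum[OF g Bk ij] sum_distrib_left mult.left_commute)
  also have "\<dots> = (g * mat_poly n c B) $$ (i, j)"
    using ij by (subst index_mult_mat_sum[OF g mat_poly_carrier]) (auto simp: mat_poly_def sum_distrib_left)
  finally show "(mat_poly n c A * g) $$ (i, j) = (g * mat_poly n c B) $$ (i, j)" .
qed (use g in \<open>auto simp: mat_poly_def\<close>)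

section \<open>Cyclicity of the first basis vector\<close>

definition hessenberg :: "nat \<Rightarrow> (nat \<Rightarrow> 'r::comm_ring_1) \<Rightarrow> 'r mat \<Rightarrow> bool" where
  "hessenberg n a A \<longleftrightarrow> A \<in> carrier_mat n n \<and>
     (\<forall>i j. i < n \<and> Suc j < i \<longrightarrow> A $$ (i, j) = 0) \<and>
     (\<forall>i. Suc i < n \<longrightarrow> A $$ (Suc i, i) = a i)"

text \<open>The columns are the iterates of \<open>A\<close> on the first basis vector;
  invertibility says that this vector is cyclic.\<close>

definition krylov :: "nat \<Rightarrow> 'r::comm_ring_1 mat \<Rightarrow> 'r mat" where
  "krylov n A = mat n n (\<lambda>(i, k). (A ^\<^sub>m k) $$ (i, 0))"

lemma krylov_carrier [simp]: "krylov n A \<in> carrier_mat n n"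
  by (simp add: krylov_def)

text \<open>Each application of \<open>A\<close> extends the support of the vector by one place and
  multiplies its lowest entry by a subdiagonal entry. Hence the Krylov matrix is upper triangular,
  with products of the \<open>a j\<close> on its diagonal.\<close>

lemma hessenberg_pow_col:
  assumes A: "hessenberg n a A" and "k < n" "i < n"
  shows "(k < i \<longrightarrow> (A ^\<^sub>m k) $$ (i, 0) = 0) \<and> (i = k \<longrightarrow> (A ^\<^sub>m k) $$ (i, 0) = (\<Prod>j<k. a j))"
  using assms(2,3)
proof (induction k arbitrary: i)
  case 0
  then show ?case using A by (auto simp: hessenberg_def)
next
  case (Suc k)
  have Ac: "A \<in> carrier_mat n n" using A by (simp add: hessenberg_def)
  then have Ak: "A ^\<^sub>m k \<in> carrier_mat n n" by simp
  have "A ^\<^sub>m Suc k = A * A ^\<^sub>m k" using pow_mat_intertwine[OF Ac Ac Ac refl, of k] by simp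
  then have sum: "(A ^\<^sub>m Suc k) $$ (i, 0) = (\<Sum>l<n. A $$ (i, l) * (A ^\<^sub>m k) $$ (l, 0))"
    using index_mult_mat_sum[OF Ac Ak, of i 0] Suc.prems by simp
  have zero: "A $$ (i, l) * (A ^\<^sub>m k) $$ (l, 0) = 0" if "l < n" "Suc k \<le> i" "l \<noteq> k \<or> Suc k < i" for l
  proof (cases "k < l")
    case True
    then show ?thesis using Suc.IH[of l] Suc.prems that by simp
  next
    case False
    then show ?thesis using A that Suc.prems by (auto simp: hessenberg_def)
  qed
  show ?case
  proof (intro conjI impI)
    assume "Suc k < i"
    then show "(A ^\<^sub>m Suc k) $$ (i, 0) = 0" unfolding sum using zero by (intro sum.neutral) auto
  next
    assume i: "i = Suc k"
    have "(A ^\<^sub>m Suc k) $$ (i, 0) = (\<Sum>l<n. if l = k then A $$ (i, k) * (A ^\<^sub>m k) $$ (k, 0) else 0)"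
      unfolding sum using zero i by (intro sum.cong refl) auto
    also have "\<dots> = a k * (\<Prod>j<k. a j)"
      using Suc.IH[of k] Suc.prems A i by (simp add: hessenberg_def)
    finally show "(A ^\<^sub>m Suc k) $$ (i, 0) = (\<Prod>j<Suc k. a j)" by (simp add: mult.commute)
  qed
qed

lemma krylov_inverse:
  assumes A: "hessenberg n a A" and a: "\<And>i. a i * a' i = 1"
  obtains M where "M \<in> carrier_mat n n" "krylov n A * M = 1\<^sub>m n" "M * krylov n A = 1\<^sub>m n"
    "\<And>i j. i < n \<Longrightarrow> j < i \<Longrightarrow> M $$ (i, j) = 0" "\<And>i. i < n \<Longrightarrow> M $$ (i, i) = (\<Prod>j<i. a' j)"
proof (rule upper_triangular_inverse[of "krylov n A" n "\<lambda>i. \<Prod>j<i. a' j"])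
  show "krylov n A $$ (i, i) * (\<Prod>j<i. a' j) = 1" if "i < n" for i
    using that hessenberg_pow_col[OF A that that] by (simp add: krylov_def prod.distrib[symmetric] a)
  show "krylov n A $$ (i, j) = 0" if "i < n" "j < i" for i j
    using that hessenberg_pow_col[OF A, of j i] by (simp add: krylov_def)
qed (use that in auto)

text \<open>A matrix commuting with \<open>A\<close> is determined by its first column, because the
  first basis vector is cyclic. The coefficients \<open>c\<close> are the coordinates of that column
  in the Krylov basis. Applied to a power of \<open>A\<close>, this takes the place of the
  Cayley-Hamilton theorem.\<close>

lemma hessenberg_centralizer:
  assumes A: "hessenberg n a A" and a: "\<And>i. a i * a' i = 1"
    and Z: "Z \<in> carrier_mat n n" "Z * A = A * Z"
  obtains c where "Z = mat_poly n c A"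
proof -
  obtain M where M: "M \<in> carrier_mat n n" "krylov n A * M = 1\<^sub>m n" "M * krylov n A = 1\<^sub>m n"
    using krylov_inverse[OF A a] by metis
  have Ac: "A \<in> carrier_mat n n" using A by (simp add: hessenberg_def)
  then have Ak: "A ^\<^sub>m k \<in> carrier_mat n n" for k by simp
  define c where "c = (\<lambda>k. (M * Z) $$ (k, 0))"
  define Y where "Y = mat_poly n c A"
  have Y: "Y \<in> carrier_mat n n" "Y * A = A * Y"
    unfolding Y_def using mat_poly_intertwine[OF Ac Ac Ac refl] by simp_all
  have MZ: "M * Z \<in> carrier_mat n n" using M(1) Z(1) by simp
  have col: "Y $$ (i, 0) = Z $$ (i, 0)" if i: "i < n" for i
  proof -
    have "Z = krylov n A * (M * Z)"
      using assoc_mult_mat[OF krylov_carrier M(1) Z(1), of A] M(2) Z(1) by simp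
    then have "Z $$ (i, 0) = (\<Sum>k<n. krylov n A $$ (i, k) * c k)"
      using index_mult_mat_sum[OF krylov_carrier MZ, of i 0 A] i by (simp add: c_def)
    also have "\<dots> = Y $$ (i, 0)" using i by (simp add: Y_def mat_poly_def krylov_def mult.commute)
    finally show ?thesis by simp
  qed
  \<comment> \<open>\<open>X\<close> applied to the Krylov vector of index \<open>j\<close> equals
    \<open>A ^\<^sub>m j\<close> applied to the first column of \<open>X\<close>.\<close>
  have commute_krylov: "(X * krylov n A) $$ (i, j) = (\<Sum>l<n. (A ^\<^sub>m j) $$ (i, l) * X $$ (l, 0))"
    if X: "X \<in> carrier_mat n n" "X * A = A * X" and ij: "i < n" "j < n" for X i j
  proof -
    have n: "0 < n" using ij by simp
    have "(X * krylov n A) $$ (i, j) = (X * A ^\<^sub>m j) $$ (i, 0)"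
      unfolding index_mult_mat_sum[OF X(1) krylov_carrier ij] index_mult_mat_sum[OF X(1) Ak ij(1) n]
      using ij by (simp add: krylov_def)
    also have "\<dots> = (A ^\<^sub>m j * X) $$ (i, 0)"
      using pow_mat_intertwine[OF Ac Ac X(1) X(2)[symmetric]] by simp
    finally show ?thesis using index_mult_mat_sum[OF Ak X(1) ij(1) n] by simp
  qed
  have "Y * krylov n A = Z * krylov n A"
  proof (rule eq_matI)
    fix i j assume "i < dim_row (Z * krylov n A)" "j < dim_col (Z * krylov n A)"
    then have "i < n" "j < n" using Z by (auto simp: krylov_def)
    then show "(Y * krylov n A) $$ (i, j) = (Z * krylov n A) $$ (i, j)"
      by (simp only: commute_krylov[OF Y] commute_krylov[OF Z]) (simp add: col)
  qed (use Y Z in auto)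
  then have "Y * krylov n A * M = Z * krylov n A * M" by simp
  then have "Y = Z"
    using assoc_mult_mat[OF Y(1) krylov_carrier M(1)] assoc_mult_mat[OF Z(1) krylov_carrier M(1)]
      M(2) Y(1) Z(1) by simp
  then show thesis using that[of c] by (simp add: Y_def)
qed

text \<open>\<open>A\<close> shifts the Krylov basis, except that the last vector goes to one which
  the monic equation expands. The resulting companion matrix depends on \<open>A\<close> only
  through \<open>c\<close>.\<close>

lemma krylov_companion:
  assumes A: "A \<in> carrier_mat n n" and c: "A ^\<^sub>m n = mat_poly n c A"
  shows "A * krylov n A = krylov n A *
    mat n n (\<lambda>(j, k). if Suc k = n then c j else if j = Suc k then 1 else 0)" (is "_ = _ * ?C")
proof (rule eq_matI)
  fix i k assume "i < dim_row (krylov n A * ?C)" "k < dim_col (krylov n A * ?C)"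
  then have ik: "i < n" "k < n" and n: "0 < n" by (auto simp: krylov_def)
  have C: "?C \<in> carrier_mat n n" by simp
  have Ak: "A ^\<^sub>m k \<in> carrier_mat n n" using A by simp
  have "(A * krylov n A) $$ (i, k) = (A * A ^\<^sub>m k) $$ (i, 0)"
    unfolding index_mult_mat_sum[OF A krylov_carrier ik] index_mult_mat_sum[OF A Ak ik(1) n]
    using ik by (simp add: krylov_def)
  also have "\<dots> = (A ^\<^sub>m Suc k) $$ (i, 0)" using pow_mat_intertwine[OF A A A refl, of k] by simp
  also have "\<dots> = (\<Sum>j<n. (A ^\<^sub>m j) $$ (i, 0) * ?C $$ (j, k))"
  proof (cases "Suc k = n")
    case True
    then have "(A ^\<^sub>m Suc k) $$ (i, 0) = mat_poly n c A $$ (i, 0)" using c by simp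
    then show ?thesis using ik True by (simp add: mat_poly_def mult.commute)
  next
    case False
    then have "(\<Sum>j<n. (A ^\<^sub>m j) $$ (i, 0) * ?C $$ (j, k))
        = (\<Sum>j<n. if j = Suc k then (A ^\<^sub>m Suc k) $$ (i, 0) else 0)"
      using ik by (intro sum.cong refl) auto
    also have "\<dots> = (A ^\<^sub>m Suc k) $$ (i, 0)" using ik False by (simp del: pow_mat.simps)
    finally show ?thesis by simp
  qed
  also have "\<dots> = (krylov n A * ?C) $$ (i, k)"
    using ik by (subst index_mult_mat_sum[OF krylov_carrier C]) (auto simp: krylov_def)
  finally show "(A * krylov n A) $$ (i, k) = (krylov n A * ?C) $$ (i, k)" .
qed (use A in \<open>auto simp: krylov_def\<close>)

text \<open>The Krylov bases carry both matrices to the same companion matrix. The diagonals of the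
  two Krylov matrices agree, since they depend only on \<open>a\<close>, so their quotient is
  unipotent and not merely invertible.\<close>

lemma hessenberg_conjugate:
  assumes A: "hessenberg n a A" and B: "hessenberg n a B" and a: "\<And>i. a i * a' i = 1"
    and cA: "A ^\<^sub>m n = mat_poly n c A" and cB: "B ^\<^sub>m n = mat_poly n c B"
  obtains u where "u \<in> UTn n" "A * u = u * B"
proof -
  obtain M where M: "M \<in> carrier_mat n n" "krylov n B * M = 1\<^sub>m n" "M * krylov n B = 1\<^sub>m n"
    "\<And>i j. i < n \<Longrightarrow> j < i \<Longrightarrow> M $$ (i, j) = 0" "\<And>i. i < n \<Longrightarrow> M $$ (i, i) = (\<Prod>j<i. a' j)"
    using krylov_inverse[OF B a] by metis
  have Ac: "A \<in> carrier_mat n n" and Bc: "B \<in> carrier_mat n n"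
    using A B by (auto simp: hessenberg_def)
  define C where "C = mat n n (\<lambda>(j, k). if Suc k = n then c j else if j = Suc k then 1 else 0)"
  have C: "C \<in> carrier_mat n n" by (simp add: C_def)
  have AK: "A * krylov n A = krylov n A * C" and BK: "B * krylov n B = krylov n B * C"
    unfolding C_def using krylov_companion[OF Ac cA] krylov_companion[OF Bc cB] by simp_all
  define u where "u = krylov n A * M"
  have lower: "i < n \<Longrightarrow> j < i \<Longrightarrow> krylov n A $$ (i, j) = 0" for i j
    using hessenberg_pow_col[OF A, of j i] by (simp add: krylov_def)
  have diag: "krylov n A $$ (i, i) * M $$ (i, i) = 1" if "i < n" for i
    using that hessenberg_pow_col[OF A that that] M(5)[OF that]
    by (simp add: krylov_def prod.distrib[symmetric] a)
  have "u \<in> UTn n"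
    unfolding u_def using mult_carrier_mat[OF krylov_carrier M(1), of A]
    by (intro UTnI) (auto simp: upper_triangular_mult[OF krylov_carrier lower M(1) M(4)] diag
        simp del: index_mult_mat(1))
  moreover have "C * M = M * B"
  proof -
    have "M * B = M * B * (krylov n B * M)" using M Bc by simp
    also have "\<dots> = M * (B * krylov n B) * M"
      using M(1) Bc krylov_carrier[of n B] by (simp add: assoc_mult_mat[of _ n n _ n _ n] mult_carrier_mat[of _ n n])
    also have "\<dots> = (M * krylov n B) * C * M"
      unfolding BK using M(1) C krylov_carrier[of n B] by (simp add: assoc_mult_mat[of _ n n _ n _ n] mult_carrier_mat[of _ n n])
    finally show ?thesis using M C by simp
  qed
  then have "A * u = u * B"
    unfolding u_def using AK assoc_mult_mat[OF Ac krylov_carrier M(1), of A, symmetric]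
      assoc_mult_mat[OF krylov_carrier C M(1), of A] assoc_mult_mat[OF krylov_carrier M(1) Bc, of A]
    by simp
  ultimately show thesis by (rule that)
qed

section \<open>Twisted transposition\<close>

text \<open>When \<open>q'\<close> inverts \<open>q\<close> pointwise, this is the transpose of
  \<open>X\<close> conjugated by the antidiagonal matrix with weights \<open>q\<close>.\<close>

definition twisted_transpose :: "nat \<Rightarrow> (nat \<Rightarrow> 'r::comm_ring_1) \<Rightarrow> (nat \<Rightarrow> 'r) \<Rightarrow> 'r mat \<Rightarrow> 'r mat" where
  "twisted_transpose n q q' X = mat n n (\<lambda>(i, j). q i * X $$ (n - Suc j, n - Suc i) * q' j)"

lemma twisted_transpose_carrier [simp]: "twisted_transpose n q q' X \<in> carrier_mat n n"
  by (simp add: twisted_transpose_def)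

lemma twisted_transpose_index:
  "i < n \<Longrightarrow> j < n \<Longrightarrow> twisted_transpose n q q' X $$ (i, j) = q i * X $$ (n - Suc j, n - Suc i) * q' j"
  by (simp add: twisted_transpose_def)

context
  fixes n :: nat and q q' :: "nat \<Rightarrow> 'r::comm_ring_1"
  assumes q: "\<And>i. q i * q' i = 1"
begin

lemma twisted_transpose_mult:
  assumes X: "X \<in> carrier_mat n n" and Y: "Y \<in> carrier_mat n n"
  shows "twisted_transpose n q q' (X * Y) = twisted_transpose n q q' Y * twisted_transpose n q q' X"
    (is "?s (X * Y) = ?s Y * ?s X")
proof (rule eq_matI)
  fix i j assume "i < dim_row (?s Y * ?s X)" "j < dim_col (?s Y * ?s X)"
  then have ij: "i < n" "j < n" by (auto simp: twisted_transpose_def)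
  then have ij': "n - Suc i < n" "n - Suc j < n" by auto
  have "(?s Y * ?s X) $$ (i, j)
      = (\<Sum>k<n. (q k * q' k) * (q i * (X $$ (n - Suc j, n - Suc k) * Y $$ (n - Suc k, n - Suc i)) * q' j))"
    unfolding index_mult_mat_sum[OF twisted_transpose_carrier twisted_transpose_carrier ij]
    using ij by (intro sum.cong refl) (simp add: twisted_transpose_index algebra_simps)
  also have "\<dots> = q i * (\<Sum>k<n. X $$ (n - Suc j, n - Suc k) * Y $$ (n - Suc k, n - Suc i)) * q' j"
    by (simp only: q mult_1_left sum_distrib_left sum_distrib_right)
  also have "\<dots> = q i * (\<Sum>k<n. X $$ (n - Suc j, k) * Y $$ (k, n - Suc i)) * q' j"
    by (subst sum.nat_diff_reindex[of "\<lambda>k. X $$ (n - Suc j, k) * Y $$ (k, n - Suc i)" n]) simp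
  also have "\<dots> = ?s (X * Y) $$ (i, j)"
    unfolding twisted_transpose_index[OF ij] index_mult_mat_sum[OF X Y ij'(2,1)] by simp
  finally show "?s (X * Y) $$ (i, j) = (?s Y * ?s X) $$ (i, j)" by simp
qed (auto simp: twisted_transpose_def)

lemma twisted_transpose_one: "twisted_transpose n q q' (1\<^sub>m n) = 1\<^sub>m n"
  by (rule eq_matI) (auto simp: twisted_transpose_def q)

lemma twisted_transpose_pow:
  assumes A: "A \<in> carrier_mat n n"
  shows "twisted_transpose n q q' (A ^\<^sub>m k) = twisted_transpose n q q' A ^\<^sub>m k"
proof (induction k)
  case 0
  then show ?case using A by (simp add: twisted_transpose_one twisted_transpose_def[of _ _ _ A])
next
  case (Suc k)
  let ?s = "twisted_transpose n q q'"
  have "?s (A ^\<^sub>m Suc k) = ?s A * ?s A ^\<^sub>m k"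
    using A Suc by (simp add: twisted_transpose_mult)
  also have "\<dots> = ?s A ^\<^sub>m k * ?s A"
    by (rule pow_mat_intertwine[of _ n, symmetric]) auto
  finally show ?case by simp
qed

lemma twisted_transpose_mat_poly:
  assumes A: "A \<in> carrier_mat n n"
  shows "twisted_transpose n q q' (mat_poly n c A) = mat_poly n c (twisted_transpose n q q' A)"
proof (rule eq_matI)
  let ?s = "twisted_transpose n q q'"
  fix i j assume "i < dim_row (mat_poly n c (?s A))" "j < dim_col (mat_poly n c (?s A))"
  then have ij: "i < n" "j < n" by (auto simp: mat_poly_def)
  have "mat_poly n c (?s A) $$ (i, j) = (\<Sum>k<n. c k * ?s (A ^\<^sub>m k) $$ (i, j))"
    using ij by (simp add: mat_poly_def twisted_transpose_pow[OF A])
  also have "\<dots> = ?s (mat_poly n c A) $$ (i, j)"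
    using ij by (simp add: twisted_transpose_index mat_poly_def sum_distrib_left sum_distrib_right algebra_simps)
  finally show "?s (mat_poly n c A) $$ (i, j) = mat_poly n c (?s A) $$ (i, j)" by simp
qed (auto simp: mat_poly_def twisted_transpose_def)

lemma det_twisted_transpose:
  assumes X: "X \<in> carrier_mat n n"
  shows "det (twisted_transpose n q q' X) = det X"
proof -
  define P where "P = mat n n (\<lambda>(i, j). if j = n - Suc i then q i else 0)"
  define P' where "P' = mat n n (\<lambda>(i, j). if i = n - Suc j then q' j else 0)"
  have P: "P \<in> carrier_mat n n" and P': "P' \<in> carrier_mat n n" by (simp_all add: P_def P'_def)
  have factor: "twisted_transpose n q q' Y = P * transpose_mat Y * P'" if Y: "Y \<in> carrier_mat n n" for Y
  proof (rule eq_matI)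
    have YT: "transpose_mat Y \<in> carrier_mat n n" using Y by simp
    have PY: "P * transpose_mat Y \<in> carrier_mat n n" using P YT by simp
    fix i j assume "i < dim_row (P * transpose_mat Y * P')" "j < dim_col (P * transpose_mat Y * P')"
    then have ij: "i < n" "j < n" by (auto simp: P_def P'_def)
    have row: "(P * transpose_mat Y) $$ (i, k) = q i * Y $$ (k, n - Suc i)" if k: "k < n" for k
    proof -
      have "(P * transpose_mat Y) $$ (i, k)
          = (\<Sum>l<n. if l = n - Suc i then q i * Y $$ (k, n - Suc i) else 0)"
        unfolding index_mult_mat_sum[OF P YT ij(1) k]
        using ij k Y by (intro sum.cong refl) (auto simp: P_def)
      then show ?thesis using ij by simp
    qed
    have "(P * transpose_mat Y * P') $$ (i, j)
        = (\<Sum>l<n. if l = n - Suc j then q i * Y $$ (n - Suc j, n - Suc i) * q' j else 0)"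
      unfolding index_mult_mat_sum[OF PY P' ij]
      using ij by (intro sum.cong refl) (auto simp: P'_def row simp del: index_mult_mat(1))
    then show "twisted_transpose n q q' Y $$ (i, j) = (P * transpose_mat Y * P') $$ (i, j)"
      using ij by (simp add: twisted_transpose_index)
  qed (auto simp: P_def P'_def twisted_transpose_def)
  \<comment> \<open>The factorisation at the identity matrix shows that \<open>P\<close> and
    \<open>P'\<close> are mutually inverse, so their determinants cancel.\<close>
  have "P * P' = 1\<^sub>m n"
    using factor[of "1\<^sub>m n"] P by (simp add: twisted_transpose_one)
  then have PP': "det P * det P' = 1" using det_mult[OF P P'] by simp
  have XT: "transpose_mat X \<in> carrier_mat n n" using X by simp
  have "det (twisted_transpose n q q' X) = det P * det X * det P'"
    using det_mult[OF mult_carrier_mat[OF P XT] P'] det_mult[OF P XT] det_transpose[OF X]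
    by (simp add: factor[OF X])
  also have "\<dots> = det X * (det P * det P')" by (simp add: algebra_simps)
  finally show ?thesis by (simp add: PP')
qed

text \<open>The determinant is carried along so that the preimage of a member of
  \<open>GLn n\<close> or \<open>SLn n\<close> lies in the same group.\<close>

lemma twisted_transpose_surj:
  assumes Y: "Y \<in> carrier_mat n n"
  obtains X where "X \<in> carrier_mat n n" "twisted_transpose n q q' X = Y" "det X = det Y"
proof -
  define X where "X = mat n n (\<lambda>(i, j). q' (n - Suc j) * Y $$ (n - Suc j, n - Suc i) * q (n - Suc i))"
  have X: "X \<in> carrier_mat n n" by (simp add: X_def)
  have sX: "twisted_transpose n q q' X = Y"
  proof (rule eq_matI)
    fix i j assume "i < dim_row Y" "j < dim_col Y"
    then have ij: "i < n" "j < n" using Y by auto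
    then have "n - Suc (n - Suc i) = i" "n - Suc (n - Suc j) = j" by auto
    then have "twisted_transpose n q q' X $$ (i, j) = (q i * q' i) * Y $$ (i, j) * (q j * q' j)"
      using ij by (simp add: twisted_transpose_index X_def algebra_simps)
    then show "twisted_transpose n q q' X $$ (i, j) = Y $$ (i, j)" by (simp add: q)
  qed (use Y in \<open>auto simp: twisted_transpose_def\<close>)
  show thesis using that[OF X sX] det_twisted_transpose[OF X] sX by simp
qed

lemma twisted_transpose_UTn:
  assumes "u \<in> UTn n"
  shows "twisted_transpose n q q' u \<in> UTn n"
proof (rule UTnI)
  fix i j assume "i < n" "j < i"
  then show "twisted_transpose n q q' u $$ (i, j) = 0"
    using UTn_lower[OF assms, of "n - Suc j" "n - Suc i"] by (simp add: twisted_transpose_index)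
next
  fix i assume "i < n"
  then show "twisted_transpose n q q' u $$ (i, i) = 1"
    using UTn_diag[OF assms, of "n - Suc i"] by (simp add: twisted_transpose_index q)
qed simp

lemma twisted_transpose_hessenberg:
  assumes A: "hessenberg n a A"
    and a: "\<And>i. Suc i < n \<Longrightarrow> q (Suc i) * a (n - Suc (Suc i)) * q' i = a i"
  shows "hessenberg n a (twisted_transpose n q q' A)"
  unfolding hessenberg_def
proof (intro conjI allI impI)
  fix i j assume "i < n \<and> Suc j < i"
  then show "twisted_transpose n q q' A $$ (i, j) = 0"
    using A by (auto simp: twisted_transpose_index hessenberg_def)
next
  fix i assume i: "Suc i < n"
  then have "Suc (n - Suc (Suc i)) = n - Suc i" by auto
  then have "A $$ (n - Suc i, n - Suc (Suc i)) = a (n - Suc (Suc i))"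
    using A i by (auto simp: hessenberg_def dest!: spec[of _ "n - Suc (Suc i)"])
  then show "twisted_transpose n q q' A $$ (Suc i, i) = a i"
    using i a by (simp add: twisted_transpose_index)
qed simp

end

section \<open>Additive characters and trace duality\<close>

text \<open>Equivalently, the kernel contains no nonzero ideal. On a finite ring such a character
  identifies the ring with its own character group.\<close>

definition generating_character :: "('r::comm_ring_1 \<Rightarrow> complex) \<Rightarrow> bool" where
  "generating_character psi \<longleftrightarrow> additive_character psi \<and> (\<forall>x. x \<noteq> 0 \<longrightarrow> (\<exists>r. psi (r * x) \<noteq> 1))"

lemma additive_character_add: "additive_character psi \<Longrightarrow> psi (x + y) = psi x * psi y"
  and additive_character_nz: "additive_character psi \<Longrightarrow> psi x \<noteq> 0"
  by (auto simp: additive_character_def)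

lemma additive_character_zero: "additive_character psi \<Longrightarrow> psi 0 = 1"
  using additive_character_add[of psi 0 0] additive_character_nz[of psi 0] by simp

lemma additive_character_minus: "additive_character psi \<Longrightarrow> psi (- x) * psi x = 1"
  using additive_character_add[of psi "- x" x] additive_character_zero[of psi] by simp

lemma additive_character_diff: "additive_character psi \<Longrightarrow> psi (x - y) * psi y = psi x"
  using additive_character_add[of psi "x - y" y] by simp

lemma additive_character_sum:
  "additive_character psi \<Longrightarrow> psi (\<Sum>i\<in>S. f i) = (\<Prod>i\<in>S. psi (f i))"
  by (induction S rule: infinite_finite_induct)
    (auto simp: additive_character_zero additive_character_add)

text \<open>The common source of the orthogonality relations below, where \<open>T\<close> is a
  translation and \<open>c\<close> the value of a character at the translating element.\<close>

lemma sum_eq_zero_by_twist: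
  fixes chi :: "'b \<Rightarrow> complex"
  assumes T: "bij_betw T S S" and chi: "\<And>x. x \<in> S \<Longrightarrow> chi (T x) = c * chi x" and "c \<noteq> 1"
  shows "sum chi S = 0"
proof -
  have "sum chi S = (\<Sum>x\<in>S. chi (T x))" using sum.reindex_bij_betw[OF T, of chi] by simp
  also have "\<dots> = c * sum chi S" by (simp add: chi sum_distrib_left)
  finally have "(1 - c) * sum chi S = 0" by (simp add: algebra_simps)
  then show ?thesis using \<open>c \<noteq> 1\<close> by simp
qed

lemma bij_add_left: "bij ((+) (x :: 'r::comm_ring_1))"
  by (rule bij_betwI[where g = "(+) (- x)"]) auto

text \<open>If \<open>chi\<close> were none of the scaled characters, orthogonality would kill the
  double sum of \<open>chi x * psi (- (a * x))\<close> when \<open>x\<close> runs first. When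
  \<open>a\<close> runs first, only \<open>x = 0\<close> survives and the sum is the cardinality of
  the ring.\<close>

lemma character_eq_scaled_generating:
  fixes psi chi :: "'r::comm_ring_1 \<Rightarrow> complex"
  assumes fin: "finite (UNIV :: 'r set)" and psi: "generating_character psi"
    and chi: "additive_character chi"
  obtains a where "\<And>x. chi x = psi (a * x)"
proof (rule ccontr)
  assume "\<not> thesis"
  then have ne: "\<exists>x. chi x \<noteq> psi (a * x)" for a using that by metis
  have add: "additive_character psi" using psi by (simp add: generating_character_def)
  have "(\<Sum>x\<in>UNIV. chi x * psi (- (a * x))) = 0" for a
  proof -
    obtain y where y: "chi y \<noteq> psi (a * y)" using ne by auto
    show ?thesis
    proof (rule sum_eq_zero_by_twist[OF bij_add_left[of y]])
      show "chi (y + x) * psi (- (a * (y + x))) = (chi y * psi (- (a * y))) * (chi x * psi (- (a * x)))" for x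
        using additive_character_add[OF add, of "- (a * y)" "- (a * x)"] additive_character_add[OF chi, of y x]
        by (simp add: algebra_simps)
      show "chi y * psi (- (a * y)) \<noteq> 1"
        using y additive_character_minus[OF add, of "a * y"]
        by (metis additive_character_nz[OF add] mult_cancel_right mult.commute)
    qed
  qed
  then have "(\<Sum>a\<in>UNIV. \<Sum>x\<in>UNIV. chi x * psi (- (a * x))) = 0" by simp
  then have "(\<Sum>x\<in>UNIV. chi x * (\<Sum>a\<in>UNIV. psi (- (a * x)))) = 0"
    by (subst (asm) sum.swap) (simp add: sum_distrib_left)
  moreover have inner: "(\<Sum>a\<in>UNIV. psi (- (a * x))) = 0" if "x \<noteq> 0" for x
  proof -
    have "- x \<noteq> 0" using that by simp
    then obtain r where r: "psi (r * - x) \<noteq> 1"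
      using psi unfolding generating_character_def by blast
    show ?thesis
    proof (rule sum_eq_zero_by_twist[OF bij_add_left[of r]])
      show "psi (- ((r + a) * x)) = psi (r * - x) * psi (- (a * x))" for a
        using additive_character_add[OF add, of "r * - x" "- (a * x)"] by (simp add: algebra_simps)
    qed (use r in simp)
  qed
  have "(\<Sum>x\<in>UNIV. chi x * (\<Sum>a\<in>UNIV. psi (- (a * x))))
      = (\<Sum>x::'r\<in>UNIV. if x = 0 then of_nat (card (UNIV :: 'r set)) else 0)"
    by (intro sum.cong refl) (auto simp: inner additive_character_zero[OF add] additive_character_zero[OF chi])
  ultimately show False using fin by simp
qed

lemma finite_carrier_mat:
  assumes "finite (UNIV :: 'r set)"
  shows "finite (carrier_mat n m :: 'r mat set)"
proof (rule finite_subset)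
  show "(carrier_mat n m :: 'r mat set) \<subseteq> mat n m ` (({..<n} \<times> {..<m}) \<rightarrow>\<^sub>E UNIV)"
  proof
    fix A :: "'r mat" assume "A \<in> carrier_mat n m"
    then have "A = mat n m (restrict (($$) A) ({..<n} \<times> {..<m}))" by (intro eq_matI) auto
    then show "A \<in> mat n m ` (({..<n} \<times> {..<m}) \<rightarrow>\<^sub>E UNIV)"
      by (intro image_eqI[where x = "restrict (($$) A) ({..<n} \<times> {..<m})"]) (simp_all only: restrict_PiE_iff UNIV_I ball_triv simp_thms)
  qed
  show "finite (mat n m ` (({..<n} \<times> {..<m}) \<rightarrow>\<^sub>E (UNIV :: 'r set)))"
    using assms by (intro finite_imageI finite_PiE) auto
qed

section \<open>The trace pairing on square matrices\<close>

definition mat_trace :: "nat \<Rightarrow> 'r::comm_ring_1 mat \<Rightarrow> 'r" where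
  "mat_trace n A = (\<Sum>i<n. A $$ (i, i))"

lemma mat_trace_mult:
  "A \<in> carrier_mat n n \<Longrightarrow> B \<in> carrier_mat n n \<Longrightarrow>
    mat_trace n (A * B) = (\<Sum>i<n. \<Sum>j<n. A $$ (i, j) * B $$ (j, i))"
  unfolding mat_trace_def by (intro sum.cong refl, subst index_mult_mat_sum[of _ n n]) auto

lemma mat_trace_commute:
  "A \<in> carrier_mat n n \<Longrightarrow> B \<in> carrier_mat n n \<Longrightarrow> mat_trace n (A * B) = mat_trace n (B * A)"
  by (simp add: mat_trace_mult) (subst sum.swap, simp add: mult.commute)

lemma mat_trace_add:
  "A \<in> carrier_mat n n \<Longrightarrow> B \<in> carrier_mat n n \<Longrightarrow> mat_trace n (A + B) = mat_trace n A + mat_trace n B"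
  by (simp add: mat_trace_def sum.distrib)

lemma mat_trace_minus:
  "A \<in> carrier_mat n n \<Longrightarrow> B \<in> carrier_mat n n \<Longrightarrow> mat_trace n (A - B) = mat_trace n A - mat_trace n B"
  by (simp add: mat_trace_def sum_subtractf)

lemma mat_trace_unit:
  assumes N: "N \<in> carrier_mat n n" and ij: "i < n" "j < n"
  shows "mat_trace n (N * mat n n (\<lambda>p. if p = (i, j) then r else 0)) = r * N $$ (j, i)"
proof -
  have "mat_trace n (N * mat n n (\<lambda>p. if p = (i, j) then r else 0))
      = (\<Sum>k<n. \<Sum>l<n. N $$ (k, l) * (if (l, k) = (i, j) then r else 0))"
    by (subst mat_trace_mult[OF N]) (auto intro!: sum.cong)
  also have "\<dots> = (\<Sum>k<n. if k = j then N $$ (j, i) * r else 0)"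
  proof (intro sum.cong refl)
    fix k assume "k \<in> {..<n}"
    have "(\<Sum>l<n. N $$ (k, l) * (if (l, k) = (i, j) then r else 0))
        = (\<Sum>l<n. if l = i then (if k = j then N $$ (j, i) * r else 0) else 0)"
      by (intro sum.cong refl) auto
    then show "(\<Sum>l<n. N $$ (k, l) * (if (l, k) = (i, j) then r else 0))
        = (if k = j then N $$ (j, i) * r else 0)" using ij by simp
  qed
  finally show ?thesis using ij by (simp add: mult.commute)
qed

text \<open>Fourier inversion on the finite group of square matrices, with characters
  \<open>\<lambda>X. psi (tr (N X))\<close>.\<close>
lemma trace_character_separates:
  fixes psi :: "'r::comm_ring_1 \<Rightarrow> complex"
  assumes fin: "finite (UNIV :: 'r set)" and psi: "generating_character psi"
    and S: "S \<subseteq> carrier_mat n n" "0\<^sub>m n n \<in> S" "\<And>s t. s \<in> S \<Longrightarrow> t \<in> S \<Longrightarrow> s + t \<in> S"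
    and D: "D \<in> carrier_mat n n" "D \<notin> S"
  shows "\<exists>N\<in>carrier_mat n n. (\<forall>s\<in>S. psi (mat_trace n (N * s)) = 1) \<and>
    psi (mat_trace n (N * D)) \<noteq> 1"
proof (rule ccontr)
  assume "\<not> ?thesis"
  then have triv: "psi (mat_trace n (N * D)) = 1"
    if "N \<in> carrier_mat n n" "\<And>s. s \<in> S \<Longrightarrow> psi (mat_trace n (N * s)) = 1" for N
    using that by blast
  have add: "additive_character psi" using psi by (simp add: generating_character_def)
  let ?C = "carrier_mat n n :: 'r mat set"
  have finC: "finite ?C" by (rule finite_carrier_mat[OF fin])
  have finS: "finite S" using S(1) finC by (rule finite_subset)
  \<comment> \<open>In a finite set closure under addition is enough: translation is injective,
    hence a permutation.\<close>
  have bij: "bij_betw ((+) s) T T"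
    if T: "T \<subseteq> ?C" "\<And>x y. x \<in> T \<Longrightarrow> y \<in> T \<Longrightarrow> x + y \<in> T" "s \<in> T" for s and T :: "'r mat set"
  proof -
    have "inj_on ((+) s) T"
    proof (rule inj_onI)
      fix x y assume xy: "x \<in> T" "y \<in> T" "s + x = s + y"
      then have C: "x \<in> ?C" "y \<in> ?C" "s \<in> ?C" using T by auto
      show "x = y"
      proof (rule eq_matI)
        fix i j assume "i < dim_row y" "j < dim_col y"
        moreover have "(s + x) $$ (i, j) = (s + y) $$ (i, j)" using xy(3) by simp
        ultimately show "x $$ (i, j) = y $$ (i, j)" using C by auto
      qed (use C in auto)
    qed
    moreover have "(+) s ` T \<subseteq> T" using T by auto
    moreover have "finite T" using T(1) finC by (rule finite_subset)
    ultimately show ?thesis by (simp add: bij_betw_def endo_inj_surj)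
  qed
  have pair_add: "mat_trace n (N * (s + t)) = mat_trace n (N * s) + mat_trace n (N * t)"
    if "N \<in> ?C" "s \<in> ?C" "t \<in> ?C" for N s t
    using that mult_add_distrib_mat[OF that] by (simp add: mat_trace_add)
  have pair_minus: "mat_trace n (N * (s - t)) = mat_trace n (N * s) - mat_trace n (N * t)"
    if "N \<in> ?C" "s \<in> ?C" "t \<in> ?C" for N s t
    using that mult_minus_distrib_mat[OF that] by (simp add: mat_trace_minus)
  have col: "(\<Sum>N\<in>?C. psi (mat_trace n (N * (s - D)))) = 0" if s: "s \<in> S" for s
  proof -
    define E where "E = s - D"
    have sC: "s \<in> ?C" using s S by auto
    have E: "E \<in> ?C" using minus_carrier_mat[OF D(1)] by (simp add: E_def)
    have "\<exists>i j. i < n \<and> j < n \<and> E $$ (i, j) \<noteq> 0"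
    proof (rule ccontr)
      assume "\<not> ?thesis"
      then have "E $$ (i, j) = 0" if "i < n" "j < n" for i j using that by blast
      then have "s = D" using sC D(1) by (intro eq_matI) (auto simp: E_def)
      then show False using s D(2) by simp
    qed
    then obtain i j where ij: "i < n" "j < n" "E $$ (i, j) \<noteq> 0" by auto
    then obtain r where r: "psi (r * E $$ (i, j)) \<noteq> 1"
      using psi by (auto simp: generating_character_def)
    define N0 where "N0 = mat n n (\<lambda>p. if p = (j, i) then r else 0)"
    have N0: "N0 \<in> ?C" by (simp add: N0_def)
    have tr0: "mat_trace n (N0 * E) = r * E $$ (i, j)"
      using mat_trace_unit[OF E ij(2,1), of r] mat_trace_commute[OF E N0] by (simp add: N0_def)
    have "(\<Sum>N\<in>?C. psi (mat_trace n (N * E))) = 0"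
    proof (rule sum_eq_zero_by_twist[OF bij[of ?C N0]])
      show "psi (mat_trace n ((N0 + N) * E)) = psi (r * E $$ (i, j)) * psi (mat_trace n (N * E))"
        if "N \<in> ?C" for N
        using add_mult_distrib_mat[OF N0 that E] N0 that E
        by (simp add: mat_trace_add[OF mult_carrier_mat mult_carrier_mat] tr0 additive_character_add[OF add])
    qed (use N0 r in auto)
    then show ?thesis by (simp add: E_def)
  qed
  define Q where "Q = {N \<in> ?C. \<forall>s\<in>S. psi (mat_trace n (N * s)) = 1}"
  have row: "(\<Sum>s\<in>S. psi (mat_trace n (N * (s - D)))) = (if N \<in> Q then of_nat (card S) else 0)"
    if N: "N \<in> ?C" for N
  proof (cases "N \<in> Q")
    case True
    have "psi (mat_trace n (N * (s - D))) = 1" if s: "s \<in> S" for s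
    proof -
      have "psi (mat_trace n (N * s)) = 1" "psi (mat_trace n (N * D)) = 1"
        using True s triv[OF N] by (auto simp: Q_def)
      moreover have "s \<in> ?C" using s S by auto
      ultimately show ?thesis
        using additive_character_diff[OF add, of "mat_trace n (N * s)" "mat_trace n (N * D)"]
        by (simp add: pair_minus[OF N _ D(1)])
    qed
    then show ?thesis using True by simp
  next
    case False
    then obtain t where t: "t \<in> S" "psi (mat_trace n (N * t)) \<noteq> 1" using N by (auto simp: Q_def)
    then have tC: "t \<in> ?C" using S by auto
    have "(\<Sum>s\<in>S. psi (mat_trace n (N * (s - D)))) = 0"
    proof (rule sum_eq_zero_by_twist[OF bij[OF S(1) S(3) t(1)]])
      show "psi (mat_trace n (N * (t + s - D))) = psi (mat_trace n (N * t)) * psi (mat_trace n (N * (s - D)))"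
        if "s \<in> S" for s
      proof -
        have sC: "s \<in> ?C" using that S by auto
        show ?thesis
          using pair_minus[OF N add_carrier_mat[OF sC, of t] D(1)] pair_add[OF N tC sC] pair_minus[OF N sC D(1)]
            additive_character_add[OF add, of "mat_trace n (N * t)" "mat_trace n (N * (s - D))"]
          by (simp add: add_diff_eq)
      qed
      show "psi (mat_trace n (N * t)) \<noteq> 1" by (rule t(2))
    qed (use S in auto)
    then show ?thesis using False by simp
  qed
  \<comment> \<open>Double counting: one order gives 0 because \<open>s - D\<close> is never zero,
    the other gives \<open>card Q * card S\<close>, and neither factor vanishes.\<close>
  have "(\<Sum>s\<in>S. \<Sum>N\<in>?C. psi (mat_trace n (N * (s - D)))) = 0" by (simp add: col)
  then have "(\<Sum>N\<in>?C. \<Sum>s\<in>S. psi (mat_trace n (N * (s - D)))) = 0" by (subst sum.swap) simp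
  then have "(\<Sum>N\<in>?C. if N \<in> Q then of_nat (card S) else 0 :: complex) = 0" by (simp add: row)
  moreover have "(\<Sum>N\<in>?C. if N \<in> Q then of_nat (card S) else 0 :: complex) = of_nat (card Q) * of_nat (card S)"
    using finC by (simp add: sum.If_cases Q_def Int_def)
  moreover have "0\<^sub>m n n \<in> Q"
    using S(1) by (auto simp: Q_def mat_trace_def additive_character_zero[OF add])
  then have "Q \<noteq> {}" by blast
  then have "card Q \<noteq> 0" using finC by (simp add: Q_def)
  moreover have "card S \<noteq> 0" using S(2) finS by auto
  ultimately show False by simp
qed

section \<open>Non-degenerate characters\<close>

text \<open>The source of the multiplicativity of \<open>theta\<close> and
  \<open>nondeg_char\<close>: both depend only on these entries.\<close>

lemma UTn_mult_superdiag:
  assumes u: "u \<in> UTn n" and v: "v \<in> UTn n" and i: "Suc i < n"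
  shows "(u * v) $$ (i, Suc i) = u $$ (i, Suc i) + v $$ (i, Suc i)"
proof -
  have i': "i < n" using i by simp
  have "(u * v) $$ (i, Suc i)
      = (\<Sum>l<n. (if l = Suc i then u $$ (i, Suc i) else 0) + (if l = i then v $$ (i, Suc i) else 0))"
    unfolding index_mult_mat_sum[OF UTn_carrier[OF u] UTn_carrier[OF v] i' i]
  proof (intro sum.cong refl)
    fix l assume l: "l \<in> {..<n}"
    consider "l < i" | "l = i" | "l = Suc i" | "Suc i < l" by linarith
    then show "u $$ (i, l) * v $$ (l, Suc i)
        = (if l = Suc i then u $$ (i, Suc i) else 0) + (if l = i then v $$ (i, Suc i) else 0)"
      using UTn_lower[OF u i', of l] UTn_lower[OF v, of l "Suc i"] UTn_diag[OF u i'] UTn_diag[OF v i] l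
      by cases auto
  qed
  then show ?thesis using i by (simp add: sum.distrib)
qed

lemma mat_diff_eq_add_swap:
  fixes P Q R T :: "'r::comm_ring_1 mat"
  assumes c: "P \<in> carrier_mat n n" "Q \<in> carrier_mat n n" "R \<in> carrier_mat n n" "T \<in> carrier_mat n n"
    and eq: "P - Q = R + T"
  shows "P - R = Q + T"
proof (rule eq_matI)
  fix i j assume "i < dim_row (Q + T)" "j < dim_col (Q + T)"
  moreover have "(P - Q) $$ (i, j) = (R + T) $$ (i, j)" by (simp only: eq)
  ultimately show "(P - R) $$ (i, j) = (Q + T) $$ (i, j)" using c by (simp add: algebra_simps)
qed (use c in auto)

lemma mat_add_add_swap:
  fixes P Q R T :: "'r::comm_ring_1 mat"
  assumes "P \<in> carrier_mat n n" "Q \<in> carrier_mat n n" "R \<in> carrier_mat n n" "T \<in> carrier_mat n n"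
  shows "(P + Q) + (R + T) = (P + R) + (Q + T)"
  using assms by (intro eq_matI) auto

text \<open>One character \<open>psi\<close> and units \<open>a i\<close> encode all the primitive
  characters, so that \<open>theta\<close> becomes a single trace functional. Asking for units at
  every index keeps the products below free of side conditions.\<close>

locale whittaker_datum =
  fixes n :: nat and psi :: "'r::comm_ring_1 \<Rightarrow> complex" and a a' :: "nat \<Rightarrow> 'r"
  assumes finite_ring: "finite (UNIV :: 'r set)" and psi: "generating_character psi"
    and a: "\<And>i. a i * a' i = 1"
begin

lemma psi_additive: "additive_character psi"
  using psi by (simp add: generating_character_def)

definition theta :: "'r mat \<Rightarrow> complex" where
  "theta u = psi (\<Sum>i<n - 1. a i * u $$ (i, Suc i))"

text \<open>The weights are chosen so that \<open>sigma\<close> fixes \<open>J\<close>.\<close>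
definition q :: "nat \<Rightarrow> 'r" where "q i = (\<Prod>k<i. a k * a' (n - Suc (Suc k)))"
definition q' :: "nat \<Rightarrow> 'r" where "q' i = (\<Prod>k<i. a' k * a (n - Suc (Suc k)))"

definition sigma :: "'r mat \<Rightarrow> 'r mat" where "sigma = twisted_transpose n q q'"

definition J :: "'r mat" where "J = mat n n (\<lambda>(i, j). if i = Suc j then a j else 0)"

lemma J_carrier [simp]: "J \<in> carrier_mat n n"
  by (simp add: J_def)

lemma q_inverse: "q i * q' i = 1"
proof -
  have "a k * a' (n - Suc (Suc k)) * (a' k * a (n - Suc (Suc k))) = 1" for k
    using a[of k] a[of "n - Suc (Suc k)"] by (metis mult.assoc mult.commute mult_1_right)
  then show ?thesis unfolding q_def q'_def prod.distrib[symmetric] by simp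
qed

text \<open>Fixing \<open>J\<close> prescribes the ratio of consecutive weights, \<open>a i\<close>
  over \<open>a (n - Suc (Suc i))\<close>; \<open>q\<close> is the product of these ratios starting
  from 1.\<close>

lemma q_subdiagonal: "q (Suc i) * a (n - Suc (Suc i)) * q' i = a i"
proof -
  have "q (Suc i) * a (n - Suc (Suc i)) * q' i
      = a i * (a (n - Suc (Suc i)) * a' (n - Suc (Suc i))) * (q i * q' i)"
    by (simp add: q_def algebra_simps)
  then show ?thesis by (simp only: a q_inverse mult_1_right)
qed

text \<open>\<open>sigma\<close> reverses the order of the superdiagonal; this identity matches each
  coefficient of \<open>theta\<close> with the one at the mirror position.\<close>

lemma q_superdiagonal: "a i * q i * q' (Suc i) = a (n - Suc (Suc i))"
proof -
  have "a i * q i * q' (Suc i) = a (n - Suc (Suc i)) * (a i * a' i) * (q i * q' i)"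
    by (simp add: q'_def algebra_simps)
  then show ?thesis by (simp only: a q_inverse mult_1_right)
qed

lemma theta_sigma: "theta (sigma u) = theta u"
proof -
  have "(\<Sum>i<n - 1. a i * sigma u $$ (i, Suc i))
      = (\<Sum>i<n - 1. a (n - 1 - Suc i) * u $$ (n - 1 - Suc i, Suc (n - 1 - Suc i)))"
  proof (intro sum.cong refl)
    fix i assume "i \<in> {..<n - 1}"
    then have i: "i < n" "Suc i < n" by auto
    then have "Suc (n - Suc (Suc i)) = n - Suc i" by auto
    moreover have "a i * sigma u $$ (i, Suc i)
        = (a i * q i * q' (Suc i)) * u $$ (n - Suc (Suc i), n - Suc i)"
      using i by (simp add: sigma_def twisted_transpose_index algebra_simps)
    ultimately show "a i * sigma u $$ (i, Suc i) = a (n - 1 - Suc i) * u $$ (n - 1 - Suc i, Suc (n - 1 - Suc i))"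
      by (simp add: q_superdiagonal)
  qed
  also have "\<dots> = (\<Sum>i<n - 1. a i * u $$ (i, Suc i))"
    by (rule sum.nat_diff_reindex)
  finally show ?thesis by (simp add: theta_def)
qed

lemma theta_one_plus:
  assumes "N \<in> carrier_mat n n"
  shows "theta (1\<^sub>m n + N) = psi (mat_trace n (N * J))"
proof -
  have "mat_trace n (N * J) = (\<Sum>i<n. \<Sum>j<n. if j = Suc i then a i * N $$ (i, Suc i) else 0)"
    unfolding mat_trace_mult[OF assms J_carrier]
    by (intro sum.cong refl) (auto simp: J_def)
  also have "\<dots> = (\<Sum>i<n. if Suc i < n then a i * N $$ (i, Suc i) else 0)"
    by (intro sum.cong refl) auto
  also have "\<dots> = (\<Sum>i<n - 1. a i * N $$ (i, Suc i))"
    by (intro sum.mono_neutral_cong_right) auto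
  also have "\<dots> = (\<Sum>i<n - 1. a i * (1\<^sub>m n + N) $$ (i, Suc i))"
    using assms by (intro sum.cong refl) auto
  finally show ?thesis by (simp add: theta_def)
qed

text \<open>Scaled matrix units on or above the diagonal isolate the entries of \<open>N\<close> on
  or below it, and a generating \<open>psi\<close> detects every nonzero entry.\<close>

lemma trace_orthogonal_upper:
  assumes N: "N \<in> carrier_mat n n"
    and orth: "\<And>X. X \<in> carrier_mat n n \<Longrightarrow> (\<And>i j. i < n \<Longrightarrow> j < i \<Longrightarrow> X $$ (i, j) = 0) \<Longrightarrow>
        psi (mat_trace n (N * X)) = 1"
  shows "1\<^sub>m n + N \<in> UTn n"
proof -
  have "N $$ (j, i) = 0" if ij: "i \<le> j" "j < n" for i j
  proof (rule ccontr)
    assume "N $$ (j, i) \<noteq> 0"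
    then obtain r where "psi (r * N $$ (j, i)) \<noteq> 1"
      using psi by (auto simp: generating_character_def)
    moreover have "psi (mat_trace n (N * mat n n (\<lambda>p. if p = (i, j) then r else 0))) = 1"
      using ij by (intro orth) auto
    ultimately show False using mat_trace_unit[OF N, of i j r] ij by simp
  qed
  then show ?thesis using N by (intro UTnI) auto
qed

text \<open>Since \<open>U = 1 + \<nn>\<close>, compatibility of \<open>theta\<close> with conjugation by \<open>g\<close> is a linear condition: it says
  that \<open>J - g J g\<^sup>-\<^sup>1\<close> is orthogonal to \<open>\<nn> \<inter> g \<nn> g\<^sup>-\<^sup>1\<close>, i.e. lies in \<open>\<bb> + g \<bb> g\<^sup>-\<^sup>1\<close> (upper triangular
  matrices).\<close>
lemma intertwining_dichotomy:
  assumes g: "g \<in> carrier_mat n n" and h: "h \<in> carrier_mat n n"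
    and gh: "g * h = 1\<^sub>m n" and hg: "h * g = 1\<^sub>m n"
  shows "(\<exists>u\<in>UTn n. \<exists>v\<in>UTn n. u * g = g * v \<and> theta u \<noteq> theta v) \<or>
    (\<exists>A B. hessenberg n a A \<and> hessenberg n a B \<and> A * g = g * B)"
proof -
  let ?ut = "\<lambda>X. X \<in> carrier_mat n n \<and> (\<forall>i j. i < n \<longrightarrow> j < i \<longrightarrow> X $$ (i, j) = 0)"
  define S where "S = {X + g * Y * h | X Y. ?ut X \<and> ?ut Y}"
  have conj_carrier: "x * Y * y \<in> carrier_mat n n"
    if "x \<in> carrier_mat n n" "Y \<in> carrier_mat n n" "y \<in> carrier_mat n n" for x Y y :: "'r mat"
    using that by (meson mult_carrier_mat)
  have assoc: "X * Y * Z = X * (Y * Z)"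
    if "X \<in> carrier_mat n n" "Y \<in> carrier_mat n n" "Z \<in> carrier_mat n n" for X Y Z :: "'r mat"
    using that by (meson assoc_mult_mat)
  define D where "D = J - g * J * h"
  have D: "D \<in> carrier_mat n n" using conj_carrier[OF g J_carrier h] by (simp add: D_def minus_carrier_mat)
  show ?thesis
  proof (cases "D \<in> S")
    case True
    then obtain X Y where XY: "?ut X" "?ut Y" "D = X + g * Y * h" by (auto simp: S_def)
    then have X: "X \<in> carrier_mat n n" and Y: "Y \<in> carrier_mat n n" by auto
    have right: "x * Z * h * g = x * Z" if "x \<in> carrier_mat n n" "Z \<in> carrier_mat n n" for x Z
      using assoc_mult_mat[OF mult_carrier_mat[OF that] h g] hg
        right_mult_one_mat[OF mult_carrier_mat[OF that]] by simp
    have c: "J * g \<in> carrier_mat n n" "X * g \<in> carrier_mat n n" "g * J \<in> carrier_mat n n"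
      "g * Y \<in> carrier_mat n n"
      using J_carrier X Y g by (meson mult_carrier_mat)+
    \<comment> \<open>Multiplying by \<open>g\<close> clears its inverse. Sorting terms by the side
      on which \<open>g\<close> stands produces the Hessenberg matrices \<open>J - X\<close> and
      \<open>J + Y\<close>.\<close>
    have "D * g = J * g - g * J"
      unfolding D_def minus_mult_distrib_mat[OF J_carrier conj_carrier[OF g J_carrier h] g]
      by (simp add: right[OF g J_carrier])
    moreover have "D * g = X * g + g * Y"
      unfolding XY(3) add_mult_distrib_mat[OF X conj_carrier[OF g Y h] g]
      by (simp add: right[OF g Y])
    ultimately have eq: "J * g - g * J = X * g + g * Y" by simp
    have "J * g - X * g = g * J + g * Y"
      by (rule mat_diff_eq_add_swap[OF c(1,3,2,4) eq])
    then have "(J - X) * g = g * (J + Y)"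
      by (simp add: minus_mult_distrib_mat[OF J_carrier X g] mult_add_distrib_mat[OF g J_carrier Y])
    moreover have "hessenberg n a (J - X)" "hessenberg n a (J + Y)"
      using XY(1,2) by (auto simp: hessenberg_def J_def minus_carrier_mat)
    ultimately show ?thesis by blast
  next
    case False
    have zero: "?ut (0\<^sub>m n n)" by auto
    have "S \<subseteq> carrier_mat n n" using conj_carrier[OF g _ h] by (auto simp: S_def)
    moreover have upper_S: "X \<in> S" if "?ut X" for X
    proof -
      have "X = X + g * 0\<^sub>m n n * h" using that g h by simp
      then show ?thesis using that zero unfolding S_def by blast
    qed
    then have "0\<^sub>m n n \<in> S" using zero by blast
    moreover have "s + t \<in> S" if "s \<in> S" "t \<in> S" for s t
    proof -
      obtain X Y where XY: "?ut X" "?ut Y" "s = X + g * Y * h" using \<open>s \<in> S\<close> by (auto simp: S_def)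
      obtain X' Y' where XY': "?ut X'" "?ut Y'" "t = X' + g * Y' * h" using \<open>t \<in> S\<close> by (auto simp: S_def)
      have Y: "Y \<in> carrier_mat n n" "Y' \<in> carrier_mat n n" using XY XY' by auto
      have "g * (Y + Y') * h = g * Y * h + g * Y' * h"
        using mult_add_distrib_mat[OF g Y] add_mult_distrib_mat[OF mult_carrier_mat[OF g Y(1)] mult_carrier_mat[OF g Y(2)] h]
        by simp
      then have "s + t = (X + X') + g * (Y + Y') * h"
        using XY XY' mat_add_add_swap[OF _ conj_carrier[OF g Y(1) h] _ conj_carrier[OF g Y(2) h], of X X'] by simp
      moreover have "?ut (X + X')" "?ut (Y + Y')" using XY XY' by auto
      ultimately show ?thesis unfolding S_def by blast
    qed
    \<comment> \<open>Orthogonality to the \<open>X\<close> makes \<open>1\<^sub>m n + N\<close>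
      unipotent, and orthogonality to the \<open>g * Y * h\<close> does so for
      \<open>1\<^sub>m n + h * N * g\<close>. These are conjugate by \<open>g\<close>, and the ratio
      of their \<open>theta\<close> values is \<open>psi (mat_trace n (N * D))\<close>.\<close>
    ultimately obtain N where N: "N \<in> carrier_mat n n"
      and orth: "\<And>s. s \<in> S \<Longrightarrow> psi (mat_trace n (N * s)) = 1" and ND: "psi (mat_trace n (N * D)) \<noteq> 1"
      using trace_character_separates[OF finite_ring psi, of S n D] D False by blast
    have hN: "h * N \<in> carrier_mat n n" and hNg: "h * N * g \<in> carrier_mat n n"
      using mult_carrier_mat[OF h N] conj_carrier[OF h N g] .
    have trace_conj: "mat_trace n (N * (g * Y * h)) = mat_trace n (h * N * g * Y)"
      if Y: "Y \<in> carrier_mat n n" for Y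
    proof -
      have gY: "g * Y \<in> carrier_mat n n" using g Y by (rule mult_carrier_mat)
      have "mat_trace n (N * (g * Y * h)) = mat_trace n (N * (g * Y) * h)"
        using assoc[OF N gY h] by simp
      also have "\<dots> = mat_trace n (h * (N * (g * Y)))"
        by (rule mat_trace_commute[OF mult_carrier_mat[OF N gY] h])
      also have "h * (N * (g * Y)) = h * N * g * Y"
        using assoc[OF h N gY] assoc[OF hN g Y] by simp
      finally show ?thesis .
    qed
    have u: "1\<^sub>m n + N \<in> UTn n"
      by (rule trace_orthogonal_upper[OF N]) (use orth upper_S in blast)
    have v: "1\<^sub>m n + h * N * g \<in> UTn n"
    proof (rule trace_orthogonal_upper[OF hNg])
      fix Y :: "'r mat" assume Y: "Y \<in> carrier_mat n n" "\<And>i j. i < n \<Longrightarrow> j < i \<Longrightarrow> Y $$ (i, j) = 0"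
      have "g * Y * h = 0\<^sub>m n n + g * Y * h" using conj_carrier[OF g Y(1) h] by simp
      then have "g * Y * h \<in> S" using Y zero unfolding S_def by blast
      then show "psi (mat_trace n (h * N * g * Y)) = 1" using orth trace_conj[OF Y(1)] by metis
    qed
    have "g * (h * N * g) = N * g"
      using assoc[OF g h mult_carrier_mat[OF N g]] assoc[OF h N g] gh
        left_mult_one_mat[OF mult_carrier_mat[OF N g]] by simp
    then have "(1\<^sub>m n + N) * g = g * (1\<^sub>m n + h * N * g)"
      by (simp only: add_mult_distrib_mat[OF one_carrier_mat N g] left_mult_one_mat[OF g]
          mult_add_distrib_mat[OF g one_carrier_mat hNg] right_mult_one_mat[OF g])
    moreover have "theta (1\<^sub>m n + N) \<noteq> theta (1\<^sub>m n + h * N * g)"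
    proof
      assume "theta (1\<^sub>m n + N) = theta (1\<^sub>m n + h * N * g)"
      then have eq: "psi (mat_trace n (N * J)) = psi (mat_trace n (h * N * g * J))"
        by (simp add: theta_one_plus[OF N] theta_one_plus[OF hNg])
      have "N * D = N * J - N * (g * J * h)"
        unfolding D_def by (rule mult_minus_distrib_mat[OF N J_carrier conj_carrier[OF g J_carrier h]])
      then have "mat_trace n (N * D) = mat_trace n (N * J) - mat_trace n (h * N * g * J)"
        using mat_trace_minus[OF mult_carrier_mat[OF N J_carrier] mult_carrier_mat[OF N conj_carrier[OF g J_carrier h]]]
        by (simp add: trace_conj)
      then have "psi (mat_trace n (N * D)) * psi (mat_trace n (N * J)) = psi (mat_trace n (N * J))"
        using additive_character_diff[OF psi_additive, of "mat_trace n (N * J)" "mat_trace n (h * N * g * J)"] eq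
        by simp
      then show False using ND additive_character_nz[OF psi_additive] by simp
    qed
    ultimately show ?thesis using u v by blast
  qed
qed

lemma theta_mult:
  assumes "u \<in> UTn n" "v \<in> UTn n"
  shows "theta (u * v) = theta u * theta v"
proof -
  have "(\<Sum>i<n - 1. a i * (u * v) $$ (i, Suc i))
      = (\<Sum>i<n - 1. a i * u $$ (i, Suc i)) + (\<Sum>i<n - 1. a i * v $$ (i, Suc i))"
    unfolding sum.distrib[symmetric]
    by (intro sum.cong refl) (simp add: UTn_mult_superdiag[OF assms] distrib_left del: index_mult_mat(1))
  then show ?thesis by (simp add: theta_def additive_character_add[OF psi_additive])
qed

text \<open>The factorisation is arranged so that \<open>sigma\<close> changes \<open>z\<close> only
  by conjugation inside \<open>UTn n\<close>, where the values of \<open>theta\<close> cancel. It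
  works because \<open>sigma\<close> preserves the Hessenberg shape, the subdiagonal and the monic
  equation of \<open>B\<close>.\<close>

lemma sigma_hessenberg_factor:
  assumes A: "hessenberg n a A" and B: "hessenberg n a B" and eq: "A * g = g * B"
    and g: "g \<in> carrier_mat n n" and h: "h \<in> carrier_mat n n"
    and gh: "g * h = 1\<^sub>m n" and hg: "h * g = 1\<^sub>m n"
  obtains u v v' z where "u \<in> UTn n" "v \<in> UTn n" "v' \<in> UTn n" "v * v' = 1\<^sub>m n"
    "z \<in> carrier_mat n n" "g = u * z" "sigma z = v * z * v'"
proof -
  have Ac: "A \<in> carrier_mat n n" and Bc: "B \<in> carrier_mat n n" using A B by (auto simp: hessenberg_def)
  have An: "A ^\<^sub>m n \<in> carrier_mat n n" and Bn: "B ^\<^sub>m n \<in> carrier_mat n n" using Ac Bc by simp_all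
  \<comment> \<open>\<open>A ^\<^sub>m n\<close> commutes with \<open>A\<close>, so it is a
    combination of lower powers: this is the monic equation.\<close>
  obtain c where c: "A ^\<^sub>m n = mat_poly n c A"
    by (rule hessenberg_centralizer[OF A a An pow_mat_intertwine[OF Ac Ac Ac refl]])
  \<comment> \<open>The invertible \<open>g\<close> transports the equation from \<open>A\<close> to
    \<open>B\<close>.\<close>
  have cB: "B ^\<^sub>m n = mat_poly n c B"
  proof -
    have "g * B ^\<^sub>m n = g * mat_poly n c B"
      using pow_mat_intertwine[OF Ac Bc g eq, of n] mat_poly_intertwine[OF Ac Bc g eq, of c] c by simp
    then have "h * (g * B ^\<^sub>m n) = h * (g * mat_poly n c B)" by simp
    then show ?thesis
      using assoc_mult_mat[OF h g Bn] assoc_mult_mat[OF h g mat_poly_carrier, of c B] hg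
        left_mult_one_mat[OF Bn] left_mult_one_mat[OF mat_poly_carrier, of n c B] by simp
  qed
  obtain u where u: "u \<in> UTn n" "A * u = u * B" using hessenberg_conjugate[OF A B a c cB] .
  obtain u' where u': "u' \<in> UTn n" "u * u' = 1\<^sub>m n" "u' * u = 1\<^sub>m n" using UTn_inverse[OF u(1)] .
  have uc: "u \<in> carrier_mat n n" and u'c: "u' \<in> carrier_mat n n" using u u' by (auto simp: UTn_carrier)
  \<comment> \<open>Both \<open>g\<close> and \<open>u\<close> intertwine \<open>A\<close> with
    \<open>B\<close>, so their quotient commutes with \<open>B\<close>.\<close>
  define z where "z = u' * g"
  have z: "z \<in> carrier_mat n n" unfolding z_def using u'c g by (rule mult_carrier_mat)
  have guz: "g = u * z" unfolding z_def using assoc_mult_mat[OF uc u'c g] u' g by simp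
  have "u * (z * B) = u * (B * z)"
    using assoc_mult_mat[OF uc z Bc] assoc_mult_mat[OF uc Bc z] assoc_mult_mat[OF Ac uc z] guz u(2) eq
    by simp
  then have "u' * (u * (z * B)) = u' * (u * (B * z))" by simp
  then have "z * B = B * z"
    using assoc_mult_mat[OF u'c uc mult_carrier_mat[OF z Bc]] assoc_mult_mat[OF u'c uc mult_carrier_mat[OF Bc z]]
      u'(3) left_mult_one_mat[OF mult_carrier_mat[OF z Bc]] left_mult_one_mat[OF mult_carrier_mat[OF Bc z]]
    by simp
  then obtain b where b: "z = mat_poly n b B" by (rule hessenberg_centralizer[OF B a z])
  have sB: "hessenberg n a (sigma B)"
    unfolding sigma_def by (rule twisted_transpose_hessenberg[OF q_inverse B q_subdiagonal])
  have sBc: "sigma B \<in> carrier_mat n n" by (simp add: sigma_def)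
  have "sigma B ^\<^sub>m n = mat_poly n c (sigma B)"
    unfolding sigma_def twisted_transpose_pow[OF q_inverse Bc, symmetric]
      twisted_transpose_mat_poly[OF q_inverse Bc, symmetric] cB ..
  then obtain v where v: "v \<in> UTn n" "sigma B * v = v * B"
    using hessenberg_conjugate[OF sB B a _ cB] by blast
  obtain v' where v': "v' \<in> UTn n" "v * v' = 1\<^sub>m n" by (rule UTn_inverse[OF v(1)])
  have vc: "v \<in> carrier_mat n n" and v'c: "v' \<in> carrier_mat n n" using v v' by (auto simp: UTn_carrier)
  have szc: "sigma z \<in> carrier_mat n n" by (simp add: sigma_def)
  have sz: "sigma z = mat_poly n b (sigma B)"
    unfolding b sigma_def by (rule twisted_transpose_mat_poly[OF q_inverse Bc])
  then have "sigma z * v = v * z"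
    using mat_poly_intertwine[OF sBc Bc vc v(2), of b] by (simp add: b)
  moreover have "sigma z = sigma z * v * v'"
    using assoc_mult_mat[OF szc vc v'c] v'(2) right_mult_one_mat[OF szc] by simp
  ultimately have "sigma z = v * z * v'" by simp
  then show thesis using that[OF u(1) v(1) v'(1,2) z guz] by simp
qed

lemma sigma_invariant:
  assumes G: "G \<subseteq> carrier_mat n n" "UTn n \<subseteq> G" "\<And>x y. x \<in> G \<Longrightarrow> y \<in> G \<Longrightarrow> x * y \<in> G"
    and sG: "\<And>x. x \<in> G \<Longrightarrow> sigma x \<in> G"
    and f: "\<And>u x. u \<in> UTn n \<Longrightarrow> x \<in> G \<Longrightarrow> f (u * x) = theta u * f x"
      "\<And>u x. u \<in> UTn n \<Longrightarrow> x \<in> G \<Longrightarrow> f (x * u) = theta u * (f x :: complex)"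
    and g: "g \<in> G" and h: "h \<in> G" "g * h = 1\<^sub>m n" "h * g = 1\<^sub>m n"
  shows "f (sigma g) = f g"
proof -
  have gc: "g \<in> carrier_mat n n" and hc: "h \<in> carrier_mat n n" using g h G by auto
  have sigma_mult: "sigma (x * y) = sigma y * sigma x"
    if "x \<in> carrier_mat n n" "y \<in> carrier_mat n n" for x y
    unfolding sigma_def by (rule twisted_transpose_mult[OF q_inverse that])
  have sigma_U: "sigma u \<in> UTn n" if "u \<in> UTn n" for u
    unfolding sigma_def by (rule twisted_transpose_UTn[OF q_inverse that])
  from intertwining_dichotomy[OF gc hc h(2,3)] show ?thesis
  proof (elim disjE bexE exE conjE)
    fix u v assume uv: "u \<in> UTn n" "v \<in> UTn n" "u * g = g * v" "theta u \<noteq> theta v"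
    \<comment> \<open>As \<open>theta u\<close> and \<open>theta v\<close> differ, \<open>f\<close>
      vanishes at \<open>g\<close>. Applying \<open>sigma\<close> to \<open>u * g = g * v\<close>
      gives a relation of the same kind for \<open>sigma g\<close>.\<close>
    have "theta u * f g = theta v * f g" using f(1)[OF uv(1) g, symmetric] f(2)[OF uv(2) g, symmetric] uv(3) by simp
    then have "f g = 0" using uv(4) by simp
    have "sigma g * sigma u = sigma v * sigma g"
      using sigma_mult[OF UTn_carrier[OF uv(1)] gc] sigma_mult[OF gc UTn_carrier[OF uv(2)]] uv(3) by simp
    then have "theta u * f (sigma g) = theta v * f (sigma g)"
      using f(2)[OF sigma_U[OF uv(1)] sG[OF g], symmetric] f(1)[OF sigma_U[OF uv(2)] sG[OF g], symmetric]
      by (simp add: theta_sigma)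
    then have "f (sigma g) = 0" using uv(4) by simp
    then show ?thesis using \<open>f g = 0\<close> by simp
  next
    fix A B assume AB: "hessenberg n a A" "hessenberg n a B" "A * g = g * B"
    obtain u v v' z where uvz: "u \<in> UTn n" "v \<in> UTn n" "v' \<in> UTn n" "v * v' = 1\<^sub>m n"
      "z \<in> carrier_mat n n" "g = u * z" "sigma z = v * z * v'"
      using sigma_hessenberg_factor[OF AB gc hc h(2,3)] .
    obtain u' where u': "u' \<in> UTn n" "u' * u = 1\<^sub>m n" by (rule UTn_inverse[OF uvz(1)])
    have "z = u' * g"
      using assoc_mult_mat[OF UTn_carrier[OF u'(1)] UTn_carrier[OF uvz(1)] uvz(5)] u'(2) uvz(5,6) by simp
    then have zG: "z \<in> G" using u'(1) G(2,3) g by auto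
    then have vzG: "v * z \<in> G" using uvz(2) G by auto
    have "theta v * theta v' = theta (1\<^sub>m n)" using theta_mult[OF uvz(2,3)] uvz(4) by simp
    also have "\<dots> = 1" by (simp add: theta_def additive_character_zero[OF psi_additive])
    finally have vv': "theta v * theta v' = 1" .
    have "f (sigma z) = theta v * theta v' * f z"
      unfolding uvz(7) using f(2)[OF uvz(3) vzG] f(1)[OF uvz(2) zG] by simp
    then have fz: "f (sigma z) = f z" using vv' by simp
    \<comment> \<open>The left factor \<open>u\<close> of \<open>g\<close> turns into the right
      factor \<open>sigma u\<close> of \<open>sigma g\<close>, with the same value of
      \<open>theta\<close>.\<close>
    have "sigma g = sigma z * sigma u"
      unfolding uvz(6) by (rule sigma_mult[OF UTn_carrier[OF uvz(1)] uvz(5)])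
    then have "f (sigma g) = theta u * f z"
      using f(2)[OF sigma_U[OF uvz(1)] sG[OF zG]] by (simp add: theta_sigma fz)
    then show ?thesis using f(1)[OF uvz(1) zG] uvz(6) by simp
  qed
qed

end

section \<open>Quotients of rings of integers\<close>

text \<open>Digit expansion: representatives modulo \<open>w ^ Suc k\<close> are those modulo
  \<open>w ^ k\<close> plus \<open>w ^ k\<close> times residue representatives.\<close>

lemma residue_representatives:
  fixes w :: "'a::idom"
  assumes fin: "finite ((UNIV :: 'a set) // {(x, y). w dvd (x - y)})"
  obtains R :: "'a set" where "finite R" "\<And>x. \<exists>r\<in>R. w ^ k dvd x - r"
proof -
  let ?E = "{(x, y). w dvd (x - y)}"
  define R0 where "R0 = (\<lambda>C. SOME y. y \<in> C) ` ((UNIV :: 'a set) // ?E)"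
  have R0: "finite R0" using fin by (simp add: R0_def)
  have rep: "\<exists>r\<in>R0. w dvd x - r" for x
  proof
    have "x \<in> ?E `` {x}" by simp
    then have "(SOME y. y \<in> ?E `` {x}) \<in> ?E `` {x}" by (rule someI)
    then show "w dvd x - (SOME y. y \<in> ?E `` {x})" by simp
    show "(SOME y. y \<in> ?E `` {x}) \<in> R0"
      unfolding R0_def by (rule image_eqI[OF refl]) (rule quotientI[OF UNIV_I])
  qed
  have "\<exists>R. finite R \<and> (\<forall>x. \<exists>r\<in>R. w ^ k dvd x - r)"
  proof (induction k)
    case 0
    then show ?case by (intro exI[of _ "{0}"]) simp
  next
    case (Suc k)
    then obtain R where R: "finite R" "\<And>x. \<exists>r\<in>R. w ^ k dvd x - r" by blast
    have "\<exists>t\<in>(\<lambda>(r, s). r + w ^ k * s) ` (R \<times> R0). w ^ Suc k dvd x - t" for x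
    proof -
      obtain r where r: "r \<in> R" "w ^ k dvd x - r" using R(2) by blast
      then obtain y where y: "x - r = w ^ k * y" by (auto elim: dvdE)
      obtain s where s: "s \<in> R0" "w dvd y - s" using rep by blast
      have "x - (r + w ^ k * s) = w ^ k * (y - s)" using y by (simp add: algebra_simps)
      then have "w ^ Suc k dvd x - (r + w ^ k * s)"
        using s(2) by (simp add: mult.commute mult_dvd_mono)
      then show ?thesis using r(1) s(1) by force
    qed
    then show ?case using R(1) R0 by (intro exI[of _ "(\<lambda>(r, s). r + w ^ k * s) ` (R \<times> R0)"]) auto
  qed
  then show thesis using that by blast
qed

lemma quotient_mod_power_finite:
  fixes w :: "'a::idom" and phi :: "'a \<Rightarrow> 'r::comm_ring_1"
  assumes w: "ring_of_integers_local_field w" and phi: "is_quotient_mod_power w l phi"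
  shows "finite (UNIV :: 'r set)"
proof -
  have fin: "finite ((UNIV :: 'a set) // {(x, y). w dvd (x - y)})"
    using w by (simp add: ring_of_integers_local_field_def)
  obtain R :: "'a set" where R: "finite R" "\<And>x. \<exists>r\<in>R. w ^ l dvd x - r"
    using residue_representatives[OF fin] by blast
  have "UNIV \<subseteq> phi ` R"
  proof
    fix y :: 'r
    have "surj phi" using phi by (simp add: is_quotient_mod_power_def)
    then obtain x where x: "y = phi x" by blast
    obtain r where r: "r \<in> R" "w ^ l dvd x - r" using R(2) by blast
    have "phi (x - r) = 0" using r phi by (simp add: is_quotient_mod_power_def)
    moreover have "phi x = phi (x - r) + phi r"
      using phi unfolding is_quotient_mod_power_def by (metis diff_add_cancel)
    ultimately show "y \<in> phi ` R" using x r(1) by simp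
  qed
  then show ?thesis using R(1) by (meson finite_imageI finite_subset)
qed

text \<open>The factorisation of a lift of \<open>x\<close> descends to the quotient; its exponent
  stays below \<open>l\<close> because \<open>x\<close> is nonzero.\<close>

lemma quotient_mod_power_decomp:
  fixes w :: "'a::idom" and phi :: "'a \<Rightarrow> 'r::comm_ring_1"
  assumes w: "ring_of_integers_local_field w" and phi: "is_quotient_mod_power w l phi"
    and x: "x \<noteq> 0"
  obtains v v' k where "v * v' = 1" "x = v * phi w ^ k" "k < l"
proof -
  have phi1: "phi 1 = 1" and phim: "\<And>x y. phi (x * y) = phi x * phi y"
    and phi0: "\<And>x. phi x = 0 \<longleftrightarrow> w ^ l dvd x" and surj: "surj phi"
    using phi by (auto simp: is_quotient_mod_power_def)
  have phip: "phi (y ^ k) = phi y ^ k" for y k by (induction k) (simp_all add: phi1 phim)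
  obtain y where y: "x = phi y" using surj by blast
  then have "y \<noteq> 0" using x phi0[of 0] by auto
  then obtain u k where u: "u dvd 1" "y = u * w ^ k"
    using w unfolding ring_of_integers_local_field_def by blast
  obtain u' where u': "1 = u * u'" using u(1) by (auto elim: dvdE)
  have "phi u * phi u' = 1" using phim[of u u'] u' phi1 by simp
  moreover have "x = phi u * phi w ^ k" by (simp add: y u(2) phim phip)
  moreover have "k < l"
  proof (rule ccontr)
    assume "\<not> k < l"
    then have "w ^ l dvd y" using u(2) by (simp add: le_imp_power_dvd)
    then show False using phi0 y x by auto
  qed
  ultimately show thesis by (rule that)
qed

lemma quotient_mod_power_uniformizer:
  assumes "is_quotient_mod_power w l phi"
  shows "phi w ^ l = 0"
proof -
  have "phi (w ^ k) = phi w ^ k" for k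
    using assms by (induction k) (auto simp: is_quotient_mod_power_def)
  then show ?thesis using assms by (metis dvd_refl is_quotient_mod_power_def)
qed

text \<open>Every nonzero ideal contains the multiples of \<open>phi w ^ (l - 1)\<close>, and a
  primitive character is nontrivial on them.\<close>

lemma primitive_generating:
  fixes w :: "'a::idom" and phi :: "'a \<Rightarrow> 'r::comm_ring_1"
  assumes w: "ring_of_integers_local_field w" and phi: "is_quotient_mod_power w l phi"
    and psi: "primitive_character (phi w) l psi"
  shows "generating_character psi"
  unfolding generating_character_def
proof (intro conjI allI impI)
  show "additive_character psi" using psi by (simp add: primitive_character_def)
  obtain y where y: "psi (phi w ^ (l - 1) * y) \<noteq> 1" using psi by (auto simp: primitive_character_def)
  fix x :: 'r assume "x \<noteq> 0"
  then obtain v v' k where v: "v * v' = 1" "x = v * phi w ^ k" "k < l"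
    by (rule quotient_mod_power_decomp[OF w phi])
  \<comment> \<open>The multiplier strips the unit from \<open>x\<close> and raises its exponent
    from \<open>k\<close> to \<open>l - 1\<close>.\<close>
  have "v' * phi w ^ (l - 1 - k) * y * x = (v * v') * (phi w ^ (l - 1 - k) * phi w ^ k) * y"
    by (simp add: v(2) algebra_simps)
  also have "\<dots> = phi w ^ (l - 1) * y" using v(1,3) by (simp add: power_add[symmetric])
  finally show "\<exists>r. psi (r * x) \<noteq> 1" using y by metis
qed

text \<open>A nonunit \<open>a\<close> would be divisible by \<open>phi w\<close> and so kill
  \<open>phi w ^ (l - 1)\<close>, against the primitivity of \<open>chi\<close>.\<close>

lemma primitive_scaled_unit:
  assumes w: "ring_of_integers_local_field w" and phi: "is_quotient_mod_power w l phi"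
    and l: "l \<ge> 1" and psi: "additive_character psi" and chi: "primitive_character (phi w) l chi"
    and a: "\<And>x. chi x = psi (a * x)"
  shows "\<exists>a'. a * a' = 1"
proof -
  obtain y where y: "chi (phi w ^ (l - 1) * y) \<noteq> 1" using chi by (auto simp: primitive_character_def)
  have nz: "a * phi w ^ (l - 1) \<noteq> 0"
    using y a[of "phi w ^ (l - 1) * y"] additive_character_zero[OF psi]
    by (metis mult.assoc mult_zero_left)
  then have "a \<noteq> 0" by auto
  then obtain v v' k where v: "v * v' = 1" "a = v * phi w ^ k" "k < l"
    by (rule quotient_mod_power_decomp[OF w phi])
  have "k = 0"
  proof (rule ccontr)
    assume "k \<noteq> 0"
    then have "phi w ^ k * phi w ^ (l - 1) = phi w ^ (k - 1) * phi w ^ l"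
      using l by (simp add: power_add[symmetric])
    then show False using nz v(2) quotient_mod_power_uniformizer[OF phi] by (simp add: mult.assoc)
  qed
  then show ?thesis using v by auto
qed

section \<open>Linear groups over the quotient and their Gelfand data\<close>

lemma mat_group_facts:
  fixes G :: "'r::comm_ring_1 mat set"
  assumes G: "G = GLn n \<or> G = SLn n"
  shows "G \<subseteq> carrier_mat n n" "1\<^sub>m n \<in> G" "UTn n \<subseteq> G"
    and "g \<in> G \<Longrightarrow> h \<in> G \<Longrightarrow> g * h \<in> G"
    and "g \<in> G \<Longrightarrow> \<exists>h\<in>G. g * h = 1\<^sub>m n \<and> h * g = 1\<^sub>m n"
    and "g \<in> G \<Longrightarrow> h \<in> carrier_mat n n \<Longrightarrow> det h = det g \<Longrightarrow> h \<in> G"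
proof -
  show sub: "G \<subseteq> carrier_mat n n" using G by (auto simp: GLn_def SLn_def)
  show "1\<^sub>m n \<in> G" using G by (auto simp: GLn_def SLn_def)
  show "UTn n \<subseteq> G" using G UTn_det UTn_carrier by (auto simp: GLn_def SLn_def)
  show "g * h \<in> G" if "g \<in> G" "h \<in> G" for g h
  proof -
    have c: "g \<in> carrier_mat n n" "h \<in> carrier_mat n n" using that sub by auto
    show ?thesis using G that det_mult[OF c] mult_carrier_mat[OF c]
      by (auto simp: GLn_def SLn_def is_unit_mult_iff)
  qed
  show "h \<in> G" if "g \<in> G" "h \<in> carrier_mat n n" "det h = det g" for g h
    using G that by (auto simp: GLn_def SLn_def)
  show "\<exists>h\<in>G. g * h = 1\<^sub>m n \<and> h * g = 1\<^sub>m n" if g: "g \<in> G" for g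
  proof -
    have gc: "g \<in> carrier_mat n n" using g sub by auto
    have "det g dvd 1" using G g by (auto simp: GLn_def SLn_def)
    then obtain e where e: "det g * e = 1" by (metis dvdE)
    define h where "h = e \<cdot>\<^sub>m adj_mat g"
    have hc: "h \<in> carrier_mat n n" using adj_mat(1)[OF gc] by (simp add: h_def)
    have gh: "g * h = 1\<^sub>m n"
      unfolding h_def using mult_smult_distrib[OF gc adj_mat(1)[OF gc]] adj_mat(2)[OF gc] e
      by (auto simp: mult.commute)
    have hg: "h * g = 1\<^sub>m n"
      unfolding h_def using mult_smult_assoc_mat[OF adj_mat(1)[OF gc] gc] adj_mat(3)[OF gc] e
      by (auto simp: mult.commute)
    have det: "det g * det h = 1" using det_mult[OF gc hc] gh by simp
    have "h \<in> G"
      using G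
    proof
      assume "G = GLn n"
      then show ?thesis using hc det by (auto simp: GLn_def dvd_def mult.commute intro: exI[of _ "det g"])
    next
      assume "G = SLn n"
      then show ?thesis using hc det g by (simp add: SLn_def)
    qed
    then show ?thesis using gh hg by blast
  qed
qed

lemma nondeg_char_mult:
  assumes psi: "\<And>i. i < n - 1 \<Longrightarrow> additive_character (psi i)" and u: "u \<in> UTn n" "v \<in> UTn n"
  shows "nondeg_char n psi (u * v) = nondeg_char n psi u * nondeg_char n psi v"
  unfolding nondeg_char_def prod.distrib[symmetric]
proof (intro prod.cong refl)
  fix i assume "i \<in> {..<n - 1}"
  then have i: "i < n - 1" "Suc i < n" by auto
  then show "psi i ((u * v) $$ (i, i + 1)) = psi i (u $$ (i, i + 1)) * psi i (v $$ (i, i + 1))"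
    using additive_character_add[OF psi[OF i(1)]] UTn_mult_superdiag[OF u i(2)] by simp
qed

lemma gelfand_data_nondeg_char:
  fixes w :: "'a::idom" and phi :: "'a \<Rightarrow> 'r::comm_ring_1"
  assumes w: "ring_of_integers_local_field w" and l: "l \<ge> 1" and phi: "is_quotient_mod_power w l phi"
    and G: "G = GLn n \<or> G = SLn n"
    and psi: "\<forall>i < n - 1. primitive_character (phi w) l (psi i)"
  shows "\<exists>sigma. gelfand_data n G (UTn n) (nondeg_char n psi) sigma"
proof -
  have fin: "finite (UNIV :: 'r set)" by (rule quotient_mod_power_finite[OF w phi])
  note Gf = mat_group_facts[OF G]
  have finG: "finite G" using Gf(1) finite_carrier_mat[OF fin] by (rule finite_subset)
  have add: "additive_character (psi i)" if "i < n - 1" for i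
    using psi that by (simp add: primitive_character_def)
  have nz: "nondeg_char n psi u \<noteq> 0" for u
    using additive_character_nz[OF add] by (simp add: nondeg_char_def)
  have data: "gelfand_data n G (UTn n) (nondeg_char n psi) s"
    if "s ` G = G" "\<And>g h. g \<in> G \<Longrightarrow> h \<in> G \<Longrightarrow> s (g * h) = s h * s g"
      and "\<And>f g. g \<in> G \<Longrightarrow>
        (\<And>u g. u \<in> UTn n \<Longrightarrow> g \<in> G \<Longrightarrow> f (u * g) = nondeg_char n psi u * f g) \<Longrightarrow>
        (\<And>u g. u \<in> UTn n \<Longrightarrow> g \<in> G \<Longrightarrow> f (g * u) = nondeg_char n psi u * f g) \<Longrightarrow>
        f (s g) = (f g :: complex)" for s
  proof
    show "finite G" by (rule finG)
    show "G \<subseteq> carrier_mat n n" "1\<^sub>m n \<in> G" "UTn n \<subseteq> G" by (fact Gf)+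
    show "g * h \<in> G" if "g \<in> G" "h \<in> G" for g h by (rule Gf(4)[OF that])
    show "\<exists>h\<in>G. g * h = 1\<^sub>m n \<and> h * g = 1\<^sub>m n" if "g \<in> G" for g by (rule Gf(5)[OF that])
    show "1\<^sub>m n \<in> UTn n" by (rule UTn_one)
    show "u * v \<in> UTn n" if "u \<in> UTn n" "v \<in> UTn n" for u v :: "'r mat" by (rule UTn_mult[OF that])
    show "\<exists>v\<in>UTn n. u * v = 1\<^sub>m n \<and> v * u = 1\<^sub>m n" if "u \<in> UTn n" for u :: "'r mat"
      using UTn_inverse[OF that] by blast
    show "nondeg_char n psi (u * v) = nondeg_char n psi u * nondeg_char n psi v"
      if "u \<in> UTn n" "v \<in> UTn n" for u v by (rule nondeg_char_mult[OF add that])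
    show "nondeg_char n psi u \<noteq> 0" for u by (rule nz)
  qed (use that in blast)+
  show ?thesis
  proof (cases "n < 2")
    \<comment> \<open>Without a superdiagonal there is no primitive character to start from. But
      \<open>G\<close> is then commutative, so the identity map serves as the
      anti-automorphism.\<close>
    case True
    have comm: "g * h = h * g" if "g \<in> G" "h \<in> G" for g h
    proof -
      have c: "g \<in> carrier_mat n n" "h \<in> carrier_mat n n" using that Gf(1) by auto
      show ?thesis
      proof (rule eq_matI)
        fix i j assume "i < dim_row (h * g)" "j < dim_col (h * g)"
        then have ij: "i < n" "j < n" using c by auto
        then have "n = 1" "i = 0" "j = 0" using True by auto
        then show "(g * h) $$ (i, j) = (h * g) $$ (i, j)"
          unfolding index_mult_mat_sum[OF c ij] index_mult_mat_sum[OF c(2,1) ij]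
          by (simp add: mult.commute)
      qed (use c in auto)
    qed
    have "gelfand_data n G (UTn n) (nondeg_char n psi) id"
      by (rule data) (simp_all add: comm)
    then show ?thesis by blast
  next
    case False
    then have n: "0 < n - 1" by simp
    have gen: "generating_character (psi 0)"
      using psi n by (intro primitive_generating[OF w phi]) auto
    \<comment> \<open>All characters are expressed through \<open>psi 0\<close>; indices from
      \<open>n - 1\<close> on receive the default unit 1.\<close>
    have "\<exists>b. (\<exists>b'. b * b' = 1) \<and> (i < n - 1 \<longrightarrow> (\<forall>x. psi i x = psi 0 (b * x)))" for i
    proof (cases "i < n - 1")
      case True
      obtain b where b: "\<And>x. psi i x = psi 0 (b * x)"
        using character_eq_scaled_generating[OF fin gen add[OF True]] by blast
      have "\<exists>b'. b * b' = 1"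
        by (rule primitive_scaled_unit[OF w phi l add[OF n] _ b]) (use psi True in simp)
      then show ?thesis using b by blast
    next
      case False
      then show ?thesis by (intro exI[of _ 1]) simp
    qed
    then have "\<forall>i. \<exists>b. (\<exists>b'. b * b' = 1) \<and> (i < n - 1 \<longrightarrow> (\<forall>x. psi i x = psi 0 (b * x)))"
      by blast
    then obtain a where ex: "\<forall>i. (\<exists>b'. a i * b' = 1) \<and> (i < n - 1 \<longrightarrow> (\<forall>x. psi i x = psi 0 (a i * x)))"
      by (rule choice[THEN exE])
    then have "\<forall>i. \<exists>b'. a i * b' = 1" by blast
    then obtain a' where "\<forall>i. a i * a' i = 1" by (rule choice[THEN exE])
    then have a: "\<And>i. a i * a' i = 1" by simp
    have psi_a: "\<And>i x. i < n - 1 \<Longrightarrow> psi i x = psi 0 (a i * x)" using ex by blast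
    interpret W: whittaker_datum n "psi 0" a a'
      by (rule whittaker_datum.intro[OF fin gen a])
    have theta: "nondeg_char n psi = W.theta"
    proof
      fix u
      show "nondeg_char n psi u = W.theta u"
        unfolding nondeg_char_def W.theta_def additive_character_sum[OF add[OF n]] Suc_eq_plus1
        by (intro prod.cong refl psi_a) simp
    qed
    have sG: "W.sigma g \<in> G" if "g \<in> G" for g
    proof -
      have "g \<in> carrier_mat n n" using that Gf(1) by auto
      then show ?thesis
        unfolding W.sigma_def by (intro Gf(6)[OF that] det_twisted_transpose[OF W.q_inverse]) simp_all
    qed
    have "gelfand_data n G (UTn n) (nondeg_char n psi) W.sigma"
    proof (rule data)
      show "W.sigma ` G = G"
      proof
        show "W.sigma ` G \<subseteq> G" using sG by blast
        show "G \<subseteq> W.sigma ` G"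
        proof
          fix y assume y: "y \<in> G"
          then have "y \<in> carrier_mat n n" using Gf(1) by auto
          then obtain x where x: "x \<in> carrier_mat n n" "W.sigma x = y" "det x = det y"
            unfolding W.sigma_def by (rule twisted_transpose_surj[OF W.q_inverse])
          then show "y \<in> W.sigma ` G" using Gf(6)[OF y x(1,3)] by blast
        qed
      qed
      show "W.sigma (g * h) = W.sigma h * W.sigma g" if "g \<in> G" "h \<in> G" for g h
        unfolding W.sigma_def by (rule twisted_transpose_mult[OF W.q_inverse]) (use that Gf(1) in auto)
      fix f :: "'r mat \<Rightarrow> complex" and g
      assume g: "g \<in> G" and f: "\<And>u g. u \<in> UTn n \<Longrightarrow> g \<in> G \<Longrightarrow> f (u * g) = nondeg_char n psi u * f g"
        "\<And>u g. u \<in> UTn n \<Longrightarrow> g \<in> G \<Longrightarrow> f (g * u) = nondeg_char n psi u * f g"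
      obtain h where h: "h \<in> G" "g * h = 1\<^sub>m n" "h * g = 1\<^sub>m n" using Gf(5)[OF g] by blast
      show "f (W.sigma g) = f g"
        by (rule W.sigma_invariant[OF Gf(1,3,4) sG f[unfolded theta] g h])
    qed
    then show ?thesis by blast
  qed
qed

theorem theorem1p1:
  fixes w :: "'a::idom" and l n :: nat and phi :: "'a \<Rightarrow> 'r::comm_ring_1"
    and G :: "'r mat set" and psi :: "nat \<Rightarrow> 'r \<Rightarrow> complex"
    and d :: nat and rho :: "'r mat \<Rightarrow> complex mat"
  assumes "ring_of_integers_local_field w"
    and "l \<ge> 2"
    and "is_quotient_mod_power w l phi"
    and "G = GLn n \<or> G = SLn n"
    and "\<forall>i < n - 1. primitive_character (phi w) l (psi i)"
    and "irreducible_rep n G d rho"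
  shows "hom_dim_le_1 G (UTn n) (nondeg_char n psi) d rho"
proof -
  have "l \<ge> 1" using assms(2) by simp
  then obtain sigma where "gelfand_data n G (UTn n) (nondeg_char n psi) sigma"
    using gelfand_data_nondeg_char[OF assms(1) _ assms(3-5)] by blast
  then interpret gelfand_rep n G "UTn n" "nondeg_char n psi" sigma d rho
    using assms(6) by (intro gelfand_rep.intro gelfand_rep_axioms.intro)
  show ?thesis by (rule multiplicity_one)
qed

end
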